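(* Let $n \ge 2$, let $\mathcal{S} = \{p_1,\dots,p_r\}$ be a finite set of distinct primes, let $\mu_1,\dots,\mu_r$ be partitions of $n$, and let $M = \prod_{i=1}^r p_i$. For integer $B\ge1$ let $\mathcal{F}_n(B)$ be the set of monic $f(x) = x^n + \sum_{j=0}^{n-1}a_jx^j \in \mathbb{Z}[x]$ with $-B < a_j \le B$ for all $j$; let $\mathcal{F}_n(B;\mathcal{S})$ be the set of $f \in \mathcal{F}_n(B)$ with $\gcd(\mathrm{Disc}(f), M) = 1$; and let $\mathcal{F}_n(B;\{\mathcal{S},\mathfrak{U}\})$ be the set of $f \in \mathcal{F}_n(B)$ such that (i) $\gcd(\mathrm{Disc}(f), M) = 1$, (ii) the splitting type of $f \bmod p_j$ is $\mu_j$ for $1\le j\le r$, and (iii) the splitting field of $f$ over $\mathbb{Q}$ has Galois group $S_n$. Then for all integers $B \ge 4nM$, $$\left|\frac{\#\mathcal{F}_n(B;\{\mathcal{S},\mathfrak{U}\})}{\#\mathcal{F}_n(B;\mathcal{S})} - \prod_{i=1}^r \nu_{n,p_i}^{\ast}(C_{\mu_i})\right| \le 2\prod_{i=1}^r\Big(1 - \frac{1}{p_i}\Big)^{-1}\alpha_n\frac{\log B}{\sqrt{B}} + \frac{4nM}{B}.$$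
   Context: $\alpha_n>0$ is a constant depending only on $n$ such that, for all integers $B > 2$, the number of $f \in \mathcal{F}_n(B)$ whose splitting field over $\mathbb{Q}$ does not have Galois group $S_n$ is at most $\alpha_n (2B)^n \frac{\log B}{\sqrt{B}}$ (such a constant exists by a theorem of Gallagher). $\mathrm{Disc}(f)$ is the polynomial discriminant; when $p \nmid \mathrm{Disc}(f)$, the splitting type of $f \bmod p$ is the partition of $n$ formed by the degrees of its (distinct) monic irreducible factors in $\mathbb{F}_p[x]$. For $m\ge1$, $M_m(X) = \frac{1}{m}\sum_{d\mid m}\mu(d)X^{m/d}$ ($\mu(d)$ the Möbius function); $\binom{w}{k} = \frac{w(w-1)\cdots(w-k+1)}{k!}$; $c_i(\mu)$ is the number of parts of $\mu$ equal to $i$; $C_\mu$ is the conjugacy class of $S_n$ of cycle type $\mu$; and $\nu_{n,p}^{\ast}(C_\mu) = \frac{1}{p^{n-1}(p-1)}\prod_{i=1}^n\binom{M_i(p)}{c_i(\mu)}$. *)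

theory Defs
  imports
    Complex_Main
    "HOL-Algebra.Algebraic_Closure_Type"
    "HOL-Algebra.Generated_Fields"
    "HOL-Algebra.QuotRing"
    "HOL-Algebra.Bij"
    "HOL-Algebra.Sym_Groups"
    "HOL-Computational_Algebra.Squarefree"
    "HOL-Library.Multiset"
    "Subresultants.Resultant_Prelim"
    "Berlekamp_Zassenhaus.Poly_Mod"
begin

definition monic_box :: "nat \<Rightarrow> int \<Rightarrow> int poly set" where
  "monic_box n B =
     {f. degree f = n \<and> lead_coeff f = 1 \<and> (\<forall>j<n. - B < coeff f j \<and> coeff f j \<le> B)}"

text \<open>The usual formula \<open>(-1)\<^bsup>n(n-1)/2\<^esup> Res(f, f') / lc(f)\<close> with \<open>n = deg f\<close>;
  the integer division is exact.\<close>

definition poly_disc :: "int poly \<Rightarrow> int" where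
  "poly_disc f =
     (- 1) ^ (degree f * (degree f - 1) div 2) * resultant f (pderiv f) div lead_coeff f"

text \<open>Polynomials over \<open>\<bbbF>\<^sub>p\<close> are represented, as in \<^theory>\<open>Berlekamp_Zassenhaus.Poly_Mod\<close>, by
  integer polynomials with coefficients in \<open>{0..<p}\<close>, that is, by the fixed points of
  \<open>poly_mod.Mp p\<close>.\<close>

definition monic_irred_factors_mod :: "nat \<Rightarrow> int poly \<Rightarrow> int poly set" where
  "monic_irred_factors_mod p f =
     {g. poly_mod.Mp (int p) g = g \<and> lead_coeff g = 1 \<and>
         poly_mod.irreducible_m (int p) g \<and> poly_mod.dvdm (int p) g f}"

text \<open>Each irreducible factor is counted once, so this is a partition of \<open>deg f\<close>
  only if \<open>f mod p\<close> is squarefree, that is, if \<open>p\<close> does not divide the discriminant.\<close>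

definition splitting_type :: "nat \<Rightarrow> int poly \<Rightarrow> nat multiset" where
  "splitting_type p f = image_mset degree (mset_set (monic_irred_factors_mod p f))"

abbreviation complex_field :: "complex ring" where
  "complex_field \<equiv> ring_of_type_algebra"

definition splitting_field :: "int poly \<Rightarrow> complex set" where
  "splitting_field f =
     generate_field complex_field (\<rat> \<union> {z. poly (map_poly of_int f) z = 0})"

text \<open>As for \<^const>\<open>Bij\<close>, automorphisms are extensional, so that each is represented by exactly
  one function.\<close>

definition galois_group :: "int poly \<Rightarrow> (complex \<Rightarrow> complex) monoid" where
  "galois_group f =
     (let K = splitting_field f; KF = complex_field\<lparr>carrier := K\<rparr>
      in BijGroup K\<lparr>carrier := {\<sigma> \<in> ring_iso KF KF \<inter> extensional K. \<forall>q\<in>\<rat>. \<sigma> q = q}\<rparr>)"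

definition has_galois_group_Sn :: "nat \<Rightarrow> int poly \<Rightarrow> bool" where
  "has_galois_group_Sn n f \<longleftrightarrow> galois_group f \<cong> sym_group n"

definition monic_box_coprime :: "nat \<Rightarrow> int \<Rightarrow> nat \<Rightarrow> int poly set" where
  "monic_box_coprime n B M = {f \<in> monic_box n B. gcd (poly_disc f) (int M) = 1}"

definition monic_box_split ::
    "nat \<Rightarrow> int \<Rightarrow> nat \<Rightarrow> (nat \<Rightarrow> nat) \<Rightarrow> (nat \<Rightarrow> nat multiset) \<Rightarrow> int poly set" where
  "monic_box_split n B r p \<mu> =
     {f \<in> monic_box n B.
        gcd (poly_disc f) (int (\<Prod>i=1..r. p i)) = 1 \<and>
        (\<forall>j\<in>{1..r}. splitting_type (p j) f = \<mu> j) \<and>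
        has_galois_group_Sn n f}"

definition is_partition_of :: "nat multiset \<Rightarrow> nat \<Rightarrow> bool" where
  "is_partition_of \<mu> n \<longleftrightarrow> 0 \<notin># \<mu> \<and> sum_mset \<mu> = n"

definition moebius :: "nat \<Rightarrow> int" where
  "moebius d = (if squarefree d then (- 1) ^ card (prime_factors d) else 0)"

definition necklace :: "nat \<Rightarrow> real \<Rightarrow> real" where
  "necklace m x = 1 / real m * (\<Sum>d | d dvd m. of_int (moebius d) * x ^ (m div d))"

text \<open>The value \<open>\<nu>\<^sup>*(C\<^sub>\<mu>)\<close>; the conjugacy class \<open>C\<^sub>\<mu>\<close> is given by its cycle type \<open>\<mu>\<close>.\<close>

definition nu_star :: "nat \<Rightarrow> nat \<Rightarrow> nat multiset \<Rightarrow> real" where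
  "nu_star n p \<mu> =
     1 / (real p ^ (n - 1) * (real p - 1)) * (\<Prod>i=1..n. necklace i (real p) gchoose count \<mu> i)"

end

theory Submission
  imports Defs "HOL-Number_Theory.Cong"
begin

text \<open>Reduction modulo \<open>M\<close> is nearly equidistributed on the box: every residue class of monic
  polynomials contains between \<open>(2B/M - 1)\<^sup>n\<close> and \<open>(2B/M + 1)\<^sup>n\<close> of them. By the Chinese remainder
  theorem the ratio of the two counts is therefore close to a product of ratios of counts over the
  fields \<open>\<bbbF>\<^sub>p\<close>, and Gallagher's bound removes the polynomials with small Galois group.

  Over \<open>\<bbbF>\<^sub>p\<close>, unique factorization identifies monic polynomials with multisets of monic
  irreducibles, so everything follows from the fact that there are \<open>p\<^sup>n\<close> multisets of degree \<open>n\<close>: this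
  determines the number of irreducibles of each degree (by Moebius inversion it is the necklace
  polynomial) and the number \<open>p\<^sup>n - p\<^bsup>n-1\<^esup>\<close> of multisets without repetition. The latter correspond to the
  polynomials with discriminant prime to \<open>p\<close>, because the discriminant is a resultant and \<open>\<bbbF>\<^sub>p\<close>
  is perfect.\<close>

section \<open>Multisets weighted by a positive function\<close>

text \<open>No power series occur, but the counts are coefficient identities of the product of
  \<open>1 / (1 - z ^ w x)\<close> over the irreducibles, which equals
  \<open>1 / (1 - q * z)\<close>. Its logarithmic derivative gives the divisor sum for the numbers
  of irreducibles, and writing a multiset as \<open>A + A + S\<close> gives
  \<open>(1 - q * z^2) / (1 - q * z)\<close> for those without repetition. The obstacle with the
  discriminant is that it is an integer resultant, whose Sylvester matrix is shaped by integer
  degrees, while the derivative loses degree modulo \<open>p\<close> when \<open>p\<close> divides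
  \<open>n\<close>. The criterion survives because \<open>f\<close> is monic, which controls the
  degrees of multiples of \<open>f\<close> modulo \<open>p\<close>. The constants come from
  \<open>x = 2 * B / M\<close>: the hypothesis on \<open>B\<close> says
  \<open>x \<ge> 8 * n\<close>, and then \<open>(x + 1) ^ n\<close> exceeds
  \<open>(x - 1) ^ n\<close> by a factor of at most \<open>1 + 8 * n / x\<close>, where
  \<open>8 * n / x\<close> is \<open>4 * n * M / B\<close>. The factor 2 before the Galois term
  comes from \<open>x ^ n \<le> 2 * (x - 1) ^ n\<close>, and the inverse factors
  \<open>1 - 1 / p\<close> come from the size of the denominator.\<close>

lemma mset_set_set_mset_distinct:
  assumes "\<forall>x. count Q x \<le> 1"
  shows "mset_set (set_mset Q) = Q"
proof (rule multiset_eqI)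
  fix x
  have "count Q x \<le> 1" using assms by blast
  then show "count (mset_set (set_mset Q)) x = count Q x"
    by (cases "x \<in># Q") (auto simp: le_Suc_eq count_eq_zero_iff)
qed

lemma sum_mset_image_eq_sum_count:
  fixes w :: "'a \<Rightarrow> nat"
  assumes "finite L" "set_mset Q \<subseteq> L"
  shows "(\<Sum>x\<in>#Q. w x) = (\<Sum>x\<in>L. count Q x * w x)"
  using assms(2)
proof (induction Q)
  case (add y Q)
  have "(\<Sum>x\<in>L. count (add_mset y Q) x * w x)
      = (\<Sum>x\<in>L. count Q x * w x + (if x = y then w y else 0))"
    by (rule sum.cong) auto
  also have "\<dots> = (\<Sum>x\<in>L. count Q x * w x) + w y"
    using add.prems assms(1) by (simp add: sum.distrib sum.delta')
  finally show ?case using add by simp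
qed simp

text \<open>Unique factorization stripped to its numerical content: \<open>I\<close> stands for the
  monic irreducibles, \<open>w\<close> for the degree and \<open>q\<close> for the prime.\<close>

locale weighted_multisets =
  fixes I :: "'a set" and w :: "'a \<Rightarrow> nat" and q :: nat
  assumes weight_pos: "x \<in> I \<Longrightarrow> w x > 0"
    and q_pos: "q > 0"
    and card_weight: "card {Q. set_mset Q \<subseteq> I \<and> (\<Sum>x\<in>#Q. w x) = n} = q ^ n"
begin

definition of_weight :: "nat \<Rightarrow> 'a multiset set" where
  "of_weight n = {Q. set_mset Q \<subseteq> I \<and> (\<Sum>x\<in>#Q. w x) = n}"

definition distinct_of_weight :: "nat \<Rightarrow> 'a multiset set" where
  "distinct_of_weight n = {Q \<in> of_weight n. \<forall>x. count Q x \<le> 1}"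

definition level :: "nat \<Rightarrow> 'a set" where
  "level m = {x \<in> I. w x = m}"

lemma card_of_weight: "card (of_weight n) = q ^ n"
  by (simp add: of_weight_def card_weight)

lemma finite_of_weight: "finite (of_weight n)"
  \<comment> \<open>An infinite set has \<open>card\<close> 0, so a positive cardinality already
    proves finiteness.\<close>
  using card_of_weight[of n] q_pos by (intro card_ge_0_finite) simp

lemma finite_distinct_of_weight: "finite (distinct_of_weight n)"
  using finite_of_weight by (simp add: distinct_of_weight_def)

text \<open>Singletons embed \<open>level m\<close> into the finite set
  \<open>of_weight m\<close>.\<close>

lemma finite_level: "finite (level m)"
proof (rule finite_imageD)
  show "finite ((\<lambda>x. {#x#}) ` level m)"
    by (rule finite_subset[OF _ finite_of_weight[of m]]) (auto simp: of_weight_def level_def)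
qed (auto simp: inj_on_def)

lemma finite_weight_le: "finite {x \<in> I. w x \<le> N}"
proof -
  have "{x \<in> I. w x \<le> N} = (\<Union>m\<le>N. level m)" by (auto simp: level_def)
  then show ?thesis by (simp add: finite_level)
qed

text \<open>Removing \<open>k\<close> copies of \<open>x\<close> inverts adding them and lowers the
  weight by \<open>k * w x\<close>.\<close>

lemma card_count_ge:
  assumes x: "x \<in> I"
  shows "card {Q \<in> of_weight n. k \<le> count Q x} = (if k * w x \<le> n then q ^ (n - k * w x) else 0)"
proof (cases "k * w x \<le> n")
  case True
  have "bij_betw (\<lambda>Q. Q + replicate_mset k x) (of_weight (n - k * w x))
          {Q \<in> of_weight n. k \<le> count Q x}"
  proof (rule bij_betw_byWitness[where f' = "\<lambda>Q. Q - replicate_mset k x"])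
    show "\<forall>Q\<in>of_weight (n - k * w x). Q + replicate_mset k x - replicate_mset k x = Q"
      by simp
    show "\<forall>Q\<in>{Q \<in> of_weight n. k \<le> count Q x}. Q - replicate_mset k x + replicate_mset k x = Q"
      by (auto simp: count_le_replicate_mset_subset_eq)
    show "(\<lambda>Q. Q + replicate_mset k x) ` of_weight (n - k * w x)
        \<subseteq> {Q \<in> of_weight n. k \<le> count Q x}"
      using x True by (auto simp: of_weight_def split: if_splits)
    show "(\<lambda>Q. Q - replicate_mset k x) ` {Q \<in> of_weight n. k \<le> count Q x}
        \<subseteq> of_weight (n - k * w x)"
    proof clarify
      fix Q assume Q: "Q \<in> of_weight n" "k \<le> count Q x"
      then have "replicate_mset k x \<subseteq># Q" by (simp add: count_le_replicate_mset_subset_eq)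
      then obtain R where "Q = replicate_mset k x + R" by (auto simp: mset_subset_eq_exists_conv)
      then show "Q - replicate_mset k x \<in> of_weight (n - k * w x)"
        using Q by (auto simp: of_weight_def)
    qed
  qed
  from bij_betw_same_card[OF this] True show ?thesis by (simp add: card_of_weight)
next
  case False
  have "{Q \<in> of_weight n. k \<le> count Q x} = {}"
  proof (rule ccontr)
    assume "\<not> ?thesis"
    then obtain Q where Q: "Q \<in> of_weight n" "k \<le> count Q x" by auto
    then have "replicate_mset k x \<subseteq># Q" by (simp add: count_le_replicate_mset_subset_eq)
    then obtain R where "Q = replicate_mset k x + R" by (auto simp: mset_subset_eq_exists_conv)
    with Q False show False by (auto simp: of_weight_def)
  qed
  then show ?thesis using False by (simp only: card.empty if_False)
qed

text \<open>A multiplicity \<open>c\<close> is the number of \<open>k\<close> with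
  \<open>1 \<le> k \<le> c\<close>, so the weight becomes a sum of indicators. The bound
  \<open>N\<close> is independent of \<open>n\<close> so that the identities for \<open>n\<close>
  and \<open>n - 1\<close> can be compared over the same index set.\<close>

lemma weight_eq_sum_indicators:
  assumes Q: "Q \<in> of_weight n" and "n \<le> N"
  shows "n = (\<Sum>x | x \<in> I \<and> w x \<le> N. \<Sum>k=1..N. if k \<le> count Q x then w x else 0)"
proof -
  have fin: "finite {x. x \<in> I \<and> w x \<le> N}" using finite_weight_le by simp
  have sub: "set_mset Q \<subseteq> {x. x \<in> I \<and> w x \<le> N}"
  proof
    fix x assume x: "x \<in># Q"
    then have "w x \<le> (\<Sum>x\<in>#Q. w x)" by (metis multi_member_split sum_mset.insert image_mset_add_mset le_add1)
    with Q x \<open>n \<le> N\<close> show "x \<in> {x. x \<in> I \<and> w x \<le> N}" by (auto simp: of_weight_def)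
  qed
  have n: "n = (\<Sum>x | x \<in> I \<and> w x \<le> N. count Q x * w x)"
    using sum_mset_image_eq_sum_count[OF fin sub, of w] Q by (simp add: of_weight_def)
  also have "\<dots> = (\<Sum>x | x \<in> I \<and> w x \<le> N. \<Sum>k=1..N. if k \<le> count Q x then w x else 0)"
  proof (rule sum.cong[OF refl])
    fix x assume x: "x \<in> {x. x \<in> I \<and> w x \<le> N}"
    \<comment> \<open>Weights are positive, so no multiplicity exceeds \<open>n\<close>, and the
      range \<open>1..N\<close> truncates nothing.\<close>
    have "count Q x * w x \<le> n" unfolding n using fin x by (intro member_le_sum) auto
    moreover have "count Q x * 1 \<le> count Q x * w x" using weight_pos[of x] x by (intro mult_le_mono) auto
    ultimately have "count Q x \<le> N" using \<open>n \<le> N\<close> by linarith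
    then have "{1..N} \<inter> {k. k \<le> count Q x} = {1..count Q x}" by auto
    then show "count Q x * w x = (\<Sum>k=1..N. if k \<le> count Q x then w x else 0)"
      by (simp add: sum.If_cases)
  qed
  finally show ?thesis .
qed

text \<open>Summing the weights over all multisets of weight \<open>n\<close> counts the pairs of a multiset and a power
  \<open>x\<^sup>k\<close> dividing it; comparing consecutive \<open>n\<close> isolates the terms with \<open>k * w x = n\<close>.\<close>

lemma weighted_card_eq:
  assumes "n \<le> N"
  shows "n * q ^ n = (\<Sum>x | x \<in> I \<and> w x \<le> N. \<Sum>k=1..N.
           if k * w x \<le> n then w x * q ^ (n - k * w x) else 0)"
proof -
  have "n * q ^ n = (\<Sum>Q\<in>of_weight n. n)" by (simp add: card_of_weight)
  also have "\<dots> = (\<Sum>Q\<in>of_weight n. \<Sum>x | x \<in> I \<and> w x \<le> N. \<Sum>k=1..N.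
      if k \<le> count Q x then w x else 0)"
    using weight_eq_sum_indicators[OF _ assms] by (rule sum.cong[OF refl])
  also have "\<dots> = (\<Sum>x | x \<in> I \<and> w x \<le> N. \<Sum>Q\<in>of_weight n. \<Sum>k=1..N.
      if k \<le> count Q x then w x else 0)" by (rule sum.swap)
  also have "\<dots> = (\<Sum>x | x \<in> I \<and> w x \<le> N. \<Sum>k=1..N. \<Sum>Q\<in>of_weight n.
      if k \<le> count Q x then w x else 0)" by (intro sum.cong[OF refl] sum.swap)
  also have "\<dots> = (\<Sum>x | x \<in> I \<and> w x \<le> N. \<Sum>k=1..N.
           if k * w x \<le> n then w x * q ^ (n - k * w x) else 0)"
  proof (intro sum.cong[OF refl])
    fix x k assume x: "x \<in> {x. x \<in> I \<and> w x \<le> N}"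
    have "(\<Sum>Q\<in>of_weight n. if k \<le> count Q x then w x else 0)
        = card {Q \<in> of_weight n. k \<le> count Q x} * w x"
      using finite_of_weight by (simp add: sum.If_cases Collect_conj_eq Int_commute)
    also have "\<dots> = (if k * w x \<le> n then w x * q ^ (n - k * w x) else 0)"
      using card_count_ge[of x n k] x by simp
    finally show "(\<Sum>Q\<in>of_weight n. if k \<le> count Q x then w x else 0) = \<dots>" .
  qed
  finally show ?thesis .
qed

text \<open>Subtracting \<open>q\<close> times the identity for \<open>n - 1\<close> from the one
  for \<open>n\<close> leaves \<open>q ^ n\<close> on one side. On the other side each
  \<open>x\<close> survives with its weight exactly when some multiple \<open>k * w x\<close> equals
  \<open>n\<close>, that is, when \<open>w x\<close> divides \<open>n\<close>.\<close>

lemma sum_divisors_card_level: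
  assumes "n > 0"
  shows "(\<Sum>m | m dvd n. m * card (level m)) = q ^ n"
proof -
  obtain m where n: "n = Suc m" using assms gr0_implies_Suc by blast
  define L where "L = {x. x \<in> I \<and> w x \<le> n}"
  have finL: "finite L" unfolding L_def using finite_weight_le by simp
  \<comment> \<open>For \<open>k * w x \<le> m\<close> the exponent drops by one, which costs a
    factor \<open>q\<close>. The new case \<open>k * w x = n\<close> has exponent 0 and is the only
    term left over.\<close>
  have step: "(if k * w x \<le> n then w x * q ^ (n - k * w x) else 0)
      = q * (if k * w x \<le> m then w x * q ^ (m - k * w x) else 0) + (if k * w x = n then w x else 0)"
    for x k
    by (auto simp: n Suc_diff_le le_Suc_eq)
  have "n * q ^ n = (\<Sum>x\<in>L. \<Sum>k=1..n.
      q * (if k * w x \<le> m then w x * q ^ (m - k * w x) else 0) + (if k * w x = n then w x else 0))"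
    unfolding weighted_card_eq[OF order.refl] L_def step ..
  also have "\<dots> = q * (\<Sum>x\<in>L. \<Sum>k=1..n. if k * w x \<le> m then w x * q ^ (m - k * w x) else 0)
      + (\<Sum>x\<in>L. \<Sum>k=1..n. if k * w x = n then w x else 0)"
    unfolding sum.distrib sum_distrib_left[symmetric] ..
  also have "(\<Sum>x\<in>L. \<Sum>k=1..n. if k * w x \<le> m then w x * q ^ (m - k * w x) else 0) = m * q ^ m"
    using weighted_card_eq[of m n] by (simp add: n L_def)
  finally have "q ^ n = (\<Sum>x\<in>L. \<Sum>k=1..n. if k * w x = n then w x else 0)"
    by (simp add: n algebra_simps)
  also have "\<dots> = (\<Sum>x\<in>L. if w x dvd n then w x else 0)"
  proof (rule sum.cong[OF refl])
    fix x assume "x \<in> L"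
    then have pos: "w x > 0" using weight_pos by (auto simp: L_def)
    show "(\<Sum>k=1..n. if k * w x = n then w x else 0) = (if w x dvd n then w x else 0)"
    proof (cases "w x dvd n")
      case True
      then obtain k where k: "n = w x * k" by auto
      then have "k dvd n" "k > 0" using assms by (auto intro: gr0I)
      then have "k \<in> {1..n}" using dvd_imp_le[of k n] assms by auto
      have eq: "(j * w x = n) = (j = k)" for j using k pos by (auto simp: mult.commute)
      show ?thesis using True \<open>k \<in> {1..n}\<close> unfolding eq by (simp add: sum.delta)
    next
      case False
      then have "k * w x \<noteq> n" for k by auto
      then show ?thesis using False by simp
    qed
  qed
  also have "\<dots> = (\<Sum>x | x \<in> L \<and> w x dvd n. w x)"
    using finL by (simp add: sum.If_cases Collect_conj_eq)
  also have "\<dots> = (\<Sum>m | m dvd n. \<Sum>x | x \<in> {x. x \<in> L \<and> w x dvd n} \<and> w x = m. w x)"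
    using finL assms by (intro sum.group[symmetric]) auto
  also have "\<dots> = (\<Sum>m | m dvd n. m * card (level m))"
  proof (rule sum.cong[OF refl])
    fix m assume m: "m \<in> {m. m dvd n}"
    then have "{x \<in> {x. x \<in> L \<and> w x dvd n}. w x = m} = level m"
      using dvd_imp_le[of m n] assms by (auto simp: L_def level_def)
    moreover have "(\<Sum>x\<in>level m. w x) = (\<Sum>x\<in>level m. m)"
      by (rule sum.cong) (auto simp: level_def)
    ultimately show "(\<Sum>x | x \<in> {x. x \<in> L \<and> w x dvd n} \<and> w x = m. w x) = m * card (level m)"
      by simp
  qed
  finally show ?thesis by simp
qed

text \<open>Every multiset is uniquely a doubled multiset plus a multiset without repetitions.\<close>

lemma card_of_weight_eq_sum_distinct:
  "q ^ n = (\<Sum>k\<le>n div 2. q ^ k * card (distinct_of_weight (n - 2 * k)))"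
proof -
  define D where "D = (SIGMA k:{..n div 2}. of_weight k \<times> distinct_of_weight (n - 2 * k))"
  define h where "h = (\<lambda>(k :: nat, A :: 'a multiset, S). A + A + S)"
  have "bij_betw h D (of_weight n)"
    unfolding bij_betw_def
  proof
    show "inj_on h D"
    proof (rule inj_onI)
      fix t t' assume t: "t \<in> D" "t' \<in> D" and eq: "h t = h t'"
      obtain k A S k' A' S' where tt: "t = (k, A, S)" "t' = (k', A', S')" by (metis prod_cases3)
      \<comment> \<open>The equation \<open>count Q x = 2 * count A x + count S x\<close> with
        \<open>count S x \<le> 1\<close> is division by 2 with remainder.\<close>
      have "count A x = count A' x \<and> count S x = count S' x" for x
      proof -
        have "count (A + A + S) x = count (A' + A' + S') x" using eq by (simp add: h_def tt)
        moreover have "count S x \<le> 1" "count S' x \<le> 1"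
          using t by (auto simp: D_def tt distinct_of_weight_def)
        ultimately show ?thesis by simp presburger
      qed
      then have "A = A'" "S = S'" by (auto intro: multiset_eqI)
      with t show "t = t'" by (auto simp: D_def tt of_weight_def)
    qed
    show "h ` D = of_weight n"
    proof (intro equalityI subsetI)
      fix Q assume "Q \<in> h ` D"
      then obtain k A S where "k \<le> n div 2" "A \<in> of_weight k" "S \<in> distinct_of_weight (n - 2 * k)"
        "Q = A + A + S" by (auto simp: D_def h_def)
      then show "Q \<in> of_weight n" by (simp add: of_weight_def distinct_of_weight_def)
    next
      fix Q assume Q: "Q \<in> of_weight n"
      \<comment> \<open>\<open>Abs_multiset\<close> needs finite support, which any \<open>g\<close>
        with \<open>g 0 = 0\<close> inherits from \<open>Q\<close>.\<close>
      have fin: "finite {x. 0 < g (count Q x)}" if "g 0 = 0" for g :: "nat \<Rightarrow> nat"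
        by (rule finite_subset[of _ "set_mset Q"]) (auto simp: that intro!: count_inI)
      define A where "A = Abs_multiset (\<lambda>x. count Q x div 2)"
      define S where "S = Abs_multiset (\<lambda>x. count Q x mod 2)"
      have cA: "count A x = count Q x div 2" for x unfolding A_def
        by (subst count_Abs_multiset) (auto intro: fin[of "\<lambda>k. k div 2"])
      have cS: "count S x = count Q x mod 2" for x unfolding S_def
        using fin[of "\<lambda>k. k mod 2"] by (subst count_Abs_multiset) simp_all
      have QAS: "Q = A + A + S" by (rule multiset_eqI) (simp add: cA cS, presburger)
      define k where "k = (\<Sum>x\<in>#A. w x)"
      have "n = k + k + (\<Sum>x\<in>#S. w x)" using Q by (subst (asm) QAS) (simp add: of_weight_def k_def)
      then have "k \<le> n div 2" "(\<Sum>x\<in>#S. w x) = n - 2 * k" by auto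
      moreover have "set_mset A \<subseteq> I" "set_mset S \<subseteq> I"
        using Q by (subst (asm) QAS, simp add: of_weight_def)+
      moreover have "count S x \<le> 1" for x unfolding cS by simp
      ultimately have "(k, A, S) \<in> D"
        by (simp add: D_def of_weight_def distinct_of_weight_def flip: k_def)
      then show "Q \<in> h ` D" using QAS by (force simp: h_def)
    qed
  qed
  then have "card (of_weight n) = card D" using bij_betw_same_card by metis
  also have "\<dots> = (\<Sum>k\<le>n div 2. card (of_weight k) * card (distinct_of_weight (n - 2 * k)))"
    unfolding D_def by (subst card_SigmaI)
      (auto simp: card_cartesian_product finite_of_weight finite_distinct_of_weight)
  finally show ?thesis by (simp add: card_of_weight)
qed

text \<open>In the decomposition for \<open>n\<close>, the terms with \<open>k \<ge> 1\<close> add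
  up to \<open>q\<close> times the whole decomposition for \<open>n - 2\<close>. Hence
  \<open>q ^ n\<close> is the wanted number plus \<open>q * q ^ (n - 2)\<close>.\<close>

lemma card_distinct_of_weight:
  assumes "n \<ge> 2"
  shows "card (distinct_of_weight n) = q ^ (n - 1) * (q - 1)"
proof -
  obtain m where n: "n = Suc (Suc m)" using assms by (metis add_2_eq_Suc le_Suc_ex)
  have "q ^ n = card (distinct_of_weight n)
      + (\<Sum>k\<le>m div 2. q ^ Suc k * card (distinct_of_weight (n - 2 * Suc k)))"
    by (subst card_of_weight_eq_sum_distinct[of n]) (simp add: n sum.atMost_Suc_shift del: sum.atMost_Suc)
  also have "(\<Sum>k\<le>m div 2. q ^ Suc k * card (distinct_of_weight (n - 2 * Suc k))) = q * q ^ m"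
    unfolding card_of_weight_eq_sum_distinct[of m] by (simp add: n sum_distrib_left mult.assoc)
  finally show ?thesis by (simp add: n algebra_simps)
qed

text \<open>A multiset without repetitions is a set. Its part in each level is an arbitrary subset
  of the prescribed size, and the choices in different levels are independent.\<close>

lemma card_distinct_of_type:
  assumes "0 \<notin># t" "\<And>i. i \<in># t \<Longrightarrow> i \<le> n"
  shows "card {Q. set_mset Q \<subseteq> I \<and> (\<forall>x. count Q x \<le> 1) \<and> image_mset w Q = t}
    = (\<Prod>i=1..n. card (level i) choose count t i)"
proof -
  define U where "U = {Q. set_mset Q \<subseteq> I \<and> (\<forall>x. count Q x \<le> 1) \<and> image_mset w Q = t}"
  define Y where "Y = PiE {1..n} (\<lambda>i. {S. S \<subseteq> level i \<and> card S = count t i})"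
  have cnt: "count (image_mset w (mset_set T)) i = card {x \<in> T. w x = i}" if "finite T" for T i
    using that by (simp add: count_image_mset vimage_def Collect_conj_eq Int_commute)
  have "bij_betw (\<lambda>Q. \<lambda>i\<in>{1..n}. {x \<in> set_mset Q. w x = i}) U Y"
  proof (rule bij_betw_byWitness[where f' = "\<lambda>F. mset_set (\<Union>i\<in>{1..n}. F i)"])
    show "\<forall>Q\<in>U. mset_set (\<Union>i\<in>{1..n}. (\<lambda>i\<in>{1..n}. {x \<in> set_mset Q. w x = i}) i) = Q"
    proof
      fix Q assume Q: "Q \<in> U"
      have "(\<Union>i\<in>{1..n}. (\<lambda>i\<in>{1..n}. {x \<in> set_mset Q. w x = i}) i) = set_mset Q"
      proof (intro equalityI subsetI)
        fix x assume x: "x \<in> set_mset Q"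
        then have "w x \<in># t" using Q by (auto simp: U_def)
        then have "w x \<in> {1..n}" using assms by (auto simp: Suc_le_eq intro: gr0I)
        with x show "x \<in> (\<Union>i\<in>{1..n}. (\<lambda>i\<in>{1..n}. {x \<in> set_mset Q. w x = i}) i)" by auto
      qed auto
      then show "mset_set (\<Union>i\<in>{1..n}. (\<lambda>i\<in>{1..n}. {x \<in> set_mset Q. w x = i}) i) = Q"
        using mset_set_set_mset_distinct[of Q] Q by (simp add: U_def)
    qed
    \<comment> \<open>Elements of \<open>F j\<close> have weight \<open>j\<close>, so
      \<open>F i\<close> can be recovered from the union as its part of weight
      \<open>i\<close>.\<close>
    have fibre: "{x \<in> \<Union>i\<in>{1..n}. F i. w x = i} = F i" if "F \<in> Y" "i \<in> {1..n}" for F i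
      using that by (fastforce simp: Y_def level_def PiE_iff)
    have fin: "finite (\<Union>i\<in>{1..n}. F i)" if "F \<in> Y" for F
    proof (rule finite_UN_I)
      fix i assume "i \<in> {1..n}"
      then have "F i \<subseteq> level i" using that by (auto simp: Y_def PiE_iff)
      then show "finite (F i)" using finite_level by (rule finite_subset)
    qed simp
    show "\<forall>F\<in>Y. (\<lambda>i\<in>{1..n}. {x \<in> set_mset (mset_set (\<Union>i\<in>{1..n}. F i)). w x = i}) = F"
    proof
      fix F assume F: "F \<in> Y"
      show "(\<lambda>i\<in>{1..n}. {x \<in> set_mset (mset_set (\<Union>i\<in>{1..n}. F i)). w x = i}) = F"
      proof
        fix i
        show "(\<lambda>i\<in>{1..n}. {x \<in> set_mset (mset_set (\<Union>i\<in>{1..n}. F i)). w x = i}) i = F i"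
        proof (cases "i \<in> {1..n}")
          case True
          then show ?thesis using fibre[OF F True] fin[OF F] by simp
        next
          case False
          then show ?thesis using F by (auto simp: Y_def PiE_def extensional_def)
        qed
      qed
    qed
    show "(\<lambda>Q. \<lambda>i\<in>{1..n}. {x \<in> set_mset Q. w x = i}) ` U \<subseteq> Y"
    proof clarify
      fix Q assume Q: "Q \<in> U"
      have "card {x \<in> set_mset Q. w x = i} = count t i" for i
        using cnt[of "set_mset Q" i] mset_set_set_mset_distinct[of Q] Q by (simp add: U_def)
      then show "(\<lambda>i\<in>{1..n}. {x \<in> set_mset Q. w x = i}) \<in> Y"
        using Q by (auto simp: Y_def U_def level_def)
    qed
    show "(\<lambda>F. mset_set (\<Union>i\<in>{1..n}. F i)) ` Y \<subseteq> U"
    proof clarify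
      fix F assume F: "F \<in> Y"
      let ?T = "\<Union>i\<in>{1..n}. F i"
      have sub: "?T \<subseteq> I" using F by (auto simp: Y_def level_def PiE_iff)
      have "image_mset w (mset_set ?T) = t"
      proof (rule multiset_eqI)
        fix i
        show "count (image_mset w (mset_set ?T)) i = count t i"
        proof (cases "i \<in> {1..n}")
          case True
          then have "card (F i) = count t i" using F by (auto simp: Y_def PiE_iff)
          then show ?thesis unfolding cnt[OF fin[OF F]] fibre[OF F True] .
        next
          case False
          have "w x \<in> {1..n}" if "x \<in> ?T" for x
            using F that by (fastforce simp: Y_def level_def PiE_iff)
          then have "{x \<in> ?T. w x = i} = {}" using False by auto
          moreover have "i \<notin># t" using False assms by (cases i) auto
          ultimately show ?thesis by (simp only: cnt[OF fin[OF F]] not_in_iff card.empty)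
        qed
      qed
      moreover have "count (mset_set ?T) x \<le> 1" for x
        using fin[OF F] by (simp add: count_mset_set')
      ultimately show "mset_set ?T \<in> U" using sub fin[OF F] by (auto simp: U_def)
    qed
  qed
  then have "card U = card Y" by (rule bij_betw_same_card)
  also have "\<dots> = (\<Prod>i=1..n. card (level i) choose count t i)"
    unfolding Y_def by (simp add: card_PiE n_subsets finite_level)
  finally show ?thesis by (simp add: U_def)
qed

end

section \<open>Moebius inversion\<close>

lemma squarefree_prime_mult_nat:
  fixes l d :: nat
  assumes "prime l" "\<not> l dvd d"
  shows "squarefree (l * d) \<longleftrightarrow> squarefree d"
proof -
  have "coprime l d" using assms by (simp add: prime_imp_coprime)
  then show ?thesis using assms(1)
    by (auto simp: squarefree_prime dest: squarefree_multD intro: squarefree_mult_coprime)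
qed

lemma moebius_prime_mult:
  assumes "prime l" "\<not> l dvd d" "d > 0"
  shows "moebius (l * d) = - moebius d"
proof -
  have "prime_factors (l * d) = insert l (prime_factors d)"
    using assms by (simp add: prime_factors_product prime_prime_factors)
  moreover have "l \<notin> prime_factors d" using assms by auto
  ultimately show ?thesis
    using squarefree_prime_mult_nat[OF assms(1,2)] by (simp add: moebius_def)
qed

text \<open>For a prime \<open>l\<close> dividing \<open>n\<close>, the squarefree divisors prime to
  \<open>l\<close> are paired with their multiples by \<open>l\<close>, and each pair contributes
  0.\<close>

lemma sum_moebius_divisors:
  assumes "n > 0"
  shows "(\<Sum>d | d dvd n. moebius d) = (if n = 1 then 1 else 0)"
proof (cases "n = 1")
  case True
  then show ?thesis by (simp add: moebius_def)
next
  case False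
  then obtain l where l: "prime l" "l dvd n" using prime_factor_nat by blast
  define E where "E = {d. d dvd n \<and> squarefree d \<and> \<not> l dvd d}"
  define F where "F = {d. d dvd n \<and> squarefree d \<and> l dvd d}"
  have fin: "finite E" "finite F" using assms by (auto simp: E_def F_def)
  have "bij_betw (\<lambda>d. l * d) E F"
    unfolding bij_betw_def
  proof
    show "inj_on (\<lambda>d. l * d) E" using l by (auto simp: inj_on_def)
    show "(\<lambda>d. l * d) ` E = F"
    proof (intro equalityI subsetI)
      fix x assume "x \<in> (\<lambda>d. l * d) ` E"
      then obtain d where d: "x = l * d" "d dvd n" "squarefree d" "\<not> l dvd d" by (auto simp: E_def)
      then show "x \<in> F"
        using l squarefree_prime_mult_nat[of l d]
        by (auto simp: F_def intro: divides_mult prime_imp_coprime)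
    next
      fix x assume x: "x \<in> F"
      then obtain d where d: "x = l * d" by (auto simp: F_def)
      have "\<not> l dvd d"
      proof
        assume "l dvd d"
        then have "l\<^sup>2 dvd x" by (auto simp: d power2_eq_square)
        then have "l dvd 1" using x by (auto simp: F_def squarefree_def)
        then show False using l by auto
      qed
      then show "x \<in> (\<lambda>d. l * d) ` E"
        using x d squarefree_prime_mult_nat[OF l(1), of d] by (auto simp: E_def F_def dest: dvd_mult_right)
    qed
  qed
  then have "(\<Sum>d\<in>F. moebius d) = (\<Sum>d\<in>E. moebius (l * d))"
    using sum.reindex_bij_betw[of "\<lambda>d. l * d" E F moebius] by simp
  also have "\<dots> = (\<Sum>d\<in>E. - moebius d)"
  proof (rule sum.cong[OF refl])
    fix d assume "d \<in> E"
    then show "moebius (l * d) = - moebius d"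
      using l(1) assms by (intro moebius_prime_mult) (auto simp: E_def intro: gr0I)
  qed
  finally have F: "(\<Sum>d\<in>F. moebius d) = - (\<Sum>d\<in>E. moebius d)" by (simp add: sum_negf)
  have "(\<Sum>d | d dvd n. moebius d) = (\<Sum>d\<in>E \<union> F. moebius d)"
    using assms by (intro sum.mono_neutral_right) (auto simp: E_def F_def moebius_def)
  also have "\<dots> = (\<Sum>d\<in>E. moebius d) + (\<Sum>d\<in>F. moebius d)"
    using fin by (intro sum.union_disjoint) (auto simp: E_def F_def)
  finally show ?thesis using F False by simp
qed

text \<open>After the order of summation is exchanged, the inner sum of Moebius values runs over the
  divisors of \<open>n div e\<close> and vanishes unless \<open>e = n\<close>.\<close>

lemma moebius_inversion:
  fixes f g :: "nat \<Rightarrow> real"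
  assumes "n > 0" and g: "\<And>k. k > 0 \<Longrightarrow> g k = (\<Sum>e | e dvd k. f e)"
  shows "(\<Sum>d | d dvd n. of_int (moebius d) * g (n div d)) = f n"
proof -
  \<comment> \<open>Both sides say that \<open>d * e\<close> divides \<open>n\<close>.\<close>
  have sym: "d dvd n \<and> e dvd n div d \<longleftrightarrow> e dvd n \<and> d dvd n div e" for d e
  proof -
    have iff: "e dvd n div d \<longleftrightarrow> e * d dvd n" if "d dvd n" for d e
      using that assms(1) by (metis dvd_div_iff_mult dvd_0_left_iff not_gr_zero)
    have "d dvd n \<and> e dvd n div d \<longleftrightarrow> e * d dvd n" for d e
      using iff by (meson dvd_mult_right)
    then show ?thesis by (metis mult.commute)
  qed
  have div_pos: "n div d > 0" if "d dvd n" for d using that assms(1) by (auto elim!: dvdE)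
  have "(\<Sum>d | d dvd n. of_int (moebius d) * g (n div d))
      = (\<Sum>d | d dvd n. \<Sum>e | e dvd n div d. of_int (moebius d) * f e)"
    by (rule sum.cong[OF refl]) (simp add: g div_pos sum_distrib_left)
  also have "\<dots> = (\<Sum>(d, e)\<in>(SIGMA d:{d. d dvd n}. {e. e dvd n div d}). of_int (moebius d) * f e)"
    using assms(1) div_pos by (subst sum.Sigma) auto
  also have "\<dots> = (\<Sum>(e, d)\<in>(SIGMA e:{e. e dvd n}. {d. d dvd n div e}). of_int (moebius d) * f e)"
    using sym by (intro sum.reindex_bij_witness[of _ "\<lambda>(e, d). (d, e)" "\<lambda>(d, e). (e, d)"]) auto
  also have "\<dots> = (\<Sum>e | e dvd n. \<Sum>d | d dvd n div e. of_int (moebius d) * f e)"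
    using assms(1) div_pos by (subst sum.Sigma) auto
  also have "\<dots> = (\<Sum>e | e dvd n. of_int (\<Sum>d | d dvd n div e. moebius d) * f e)"
    by (simp add: sum_distrib_right)
  also have "\<dots> = (\<Sum>e | e dvd n. if e = n then f e else 0)"
  proof (rule sum.cong[OF refl])
    fix e assume "e \<in> {e. e dvd n}"
    moreover from this have "n div e = 1 \<longleftrightarrow> e = n" using assms(1) by (auto elim!: dvdE)
    ultimately show "of_int (\<Sum>d | d dvd n div e. moebius d) * f e = (if e = n then f e else 0)"
      using sum_moebius_divisors[OF div_pos, of e] by (simp del: of_int_sum)
  qed
  also have "\<dots> = f n" using assms(1) by (simp add: sum.delta)
  finally show ?thesis .
qed

text \<open>Inversion is applied to the function \<open>e * N e\<close>; the factor
  \<open>1 / n\<close> in \<open>necklace\<close> then removes the weight \<open>n\<close>.\<close>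

lemma necklace_eq_if_sum_divisors:
  assumes "n > 0" and N: "\<And>k. k > 0 \<Longrightarrow> (\<Sum>m | m dvd k. m * N m) = q ^ k"
  shows "necklace n (real q) = real (N n)"
proof -
  have "(\<Sum>d | d dvd n. of_int (moebius d) * real q ^ (n div d)) = real n * real (N n)"
  proof (rule moebius_inversion[OF assms(1)])
    fix k :: nat assume "k > 0"
    from N[OF this] have "real (\<Sum>m | m dvd k. m * N m) = real (q ^ k)" by simp
    then show "real q ^ k = (\<Sum>e | e dvd k. real e * real (N e))" by simp
  qed
  then show ?thesis using assms(1) by (simp add: necklace_def)
qed

section \<open>Unique factorization modulo a prime\<close>

text \<open>Pseudo-division scales \<open>f\<close> by a power of the leading coefficient of
  \<open>g\<close>, which is 1 here.\<close>

lemma monic_division: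
  fixes f g :: "'a :: idom poly"
  assumes "monic g"
  obtains q r where "f = g * q + r" "r = 0 \<or> degree r < degree g"
proof -
  obtain q r where "pseudo_divmod f g = (q, r)" by force
  moreover have "g \<noteq> 0" using assms by auto
  ultimately show ?thesis
    using pseudo_divmod[of g f q r] assms that[of q r] by simp
qed

lemma degree_mult_monic:
  fixes f g :: "'a :: idom poly"
  assumes "monic f" "monic g"
  shows "degree (f * g) = degree f + degree g"
proof -
  have "f \<noteq> 0" "g \<noteq> 0" using assms by force+
  then show ?thesis by (rule degree_mult_eq)
qed

context poly_mod
begin

lemma Mp_add_cong: "Mp a = Mp a' \<Longrightarrow> Mp b = Mp b' \<Longrightarrow> Mp (a + b) = Mp (a' + b')"
  by (metis plus_Mp)

lemma Mp_diff_cong: "Mp a = Mp a' \<Longrightarrow> Mp b = Mp b' \<Longrightarrow> Mp (a - b) = Mp (a' - b')"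
  by (metis minus_Mp)

lemma Mp_mult_cong: "Mp a = Mp a' \<Longrightarrow> Mp b = Mp b' \<Longrightarrow> Mp (a * b) = Mp (a' * b')"
  by (metis mult_Mp)

lemma Mp_eq_iff_dvd: "Mp f = Mp g \<longleftrightarrow> [:m:] dvd f - g"
  by (simp add: poly_eq_iff Mp_coeff M_def const_poly_dvd_iff mod_eq_dvd_iff)

lemma dvdm_refl: "f dvdm f" by (rule dvd_imp_dvdm) simp

lemma dvdm_trans:
  assumes "f dvdm g" "g dvdm h"
  shows "f dvdm h"
proof -
  obtain a b where a: "Mp g = Mp (f * a)" and b: "Mp h = Mp (g * b)"
    using assms by (auto simp: dvdm_def)
  have "Mp (g * b) = Mp (f * a * b)" using a by (rule Mp_mult_cong) simp
  then have "Mp h = Mp (f * (a * b))" using b by (simp add: mult.assoc)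
  then show ?thesis unfolding dvdm_def by blast
qed

lemma dvdm_cong: "Mp f = Mp f' \<Longrightarrow> Mp g = Mp g' \<Longrightarrow> f dvdm g \<longleftrightarrow> f' dvdm g'"
  by (metis Mp_dvdm dvdm_Mp)

lemma dvdm_mult_left: "f dvdm g \<Longrightarrow> f dvdm h * g"
  using dvdm_factor[of f g h] by (simp add: mult.commute)

end

context poly_mod_2
begin

lemma monic_dvdm_1D:
  assumes "monic d" "d dvdm 1"
  shows "d = 1"
proof -
  have "degree d \<le> degree (1 :: int poly)" using assms by (intro dvdm_degree) auto
  then show ?thesis using assms(1) by (auto elim!: degree_eq_zeroE)
qed

text \<open>The modulus may be composite in this context. Since \<open>f\<close> is monic, the top
  coefficient of the product is that of \<open>Mp g\<close>, which is nonzero and already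
  reduced.\<close>

lemma degree_Mp_monic_mult:
  assumes "monic f" "Mp g \<noteq> 0"
  shows "degree_m (f * g) = degree f + degree_m g"
proof -
  have "lead_coeff (Mp g) mod m = lead_coeff (Mp g)" by (metis M_M M_def Mp_coeff)
  then have "lead_coeff (Mp g) mod m \<noteq> 0" using assms(2) by simp
  from degree_m_mult_eq[OF assms(1) this m1] show ?thesis by simp
qed

lemma monic_mult_eq_0_mod:
  assumes "monic f" "Mp (f * g) = 0"
  shows "Mp g = 0"
proof (rule ccontr)
  assume g: "Mp g \<noteq> 0"
  have lc: "lead_coeff (Mp g) mod m = lead_coeff (Mp g)" by (metis M_M M_def Mp_coeff)
  have "lead_coeff (f * Mp g) = lead_coeff (Mp g)" using assms(1) by (simp add: lead_coeff_mult)
  then have "coeff (Mp (f * Mp g)) (degree (f * Mp g)) = lead_coeff (Mp g)"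
    using lc by (simp only: Mp_coeff[of "f * Mp g"] M_def)
  with assms(2) g show False by simp
qed

lemma monic_mult_cancel_mod:
  assumes "monic f" "Mp (f * g) = Mp (f * h)"
  shows "Mp g = Mp h"
proof -
  have "Mp (f * (g - h)) = Mp (f * g - f * h)" by (simp add: algebra_simps)
  also have "\<dots> = Mp (f * h - f * h)" by (rule Mp_diff_cong) (simp_all add: assms)
  finally have "Mp (g - h) = 0" using monic_mult_eq_0_mod[OF assms(1)] by simp
  then have "Mp (g - h + h) = Mp (0 + h)" by (intro Mp_add_cong) simp_all
  then show ?thesis by simp
qed

end

section \<open>Bezout's identity and Euclid's lemma modulo a prime\<close>

context poly_mod_prime
begin

text \<open>A nonzero reduced leading coefficient is prime to \<open>p\<close>, and Bezout's
  identity for these two integers provides the scalar \<open>c\<close> that inverts it.\<close>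

lemma make_monic_mod:
  assumes "Mp f \<noteq> 0"
  obtains c s where "monic s" "degree s = degree_m f" "Mp s = Mp (smult c f)"
proof -
  let ?l = "lead_coeff (Mp f)"
  have l: "?l mod p = ?l" by (metis M_M M_def Mp_coeff)
  have "\<not> p dvd ?l" using l assms by (auto simp: mod_0_imp_dvd dvd_eq_mod_eq_0)
  then have "algebraic_semidom_class.coprime p ?l" by (rule prime_imp_coprime[OF prime])
  then have "algebraic_semidom_class.coprime ?l p" by (simp only: algebraic_semidom_class.coprime_commute)
  then have "gcd ?l p = 1" by (simp add: coprime_iff_gcd_eq_1)
  then obtain c v where "c * ?l + v * p = 1" using bezout_int by metis
  then have "c * ?l = 1 + p * (- v)" by (simp add: algebra_simps)
  then have "M (c * ?l) = (1 + p * (- v)) mod p" by (simp only: M_def)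
  then have c: "M (c * ?l) = 1" using m1 by (simp only: mod_mult_self2) simp
  let ?s = "Mp (smult c (Mp f))"
  have co: "coeff ?s (degree_m f) = 1" using c by (simp add: Mp_coeff)
  have "degree ?s \<le> degree_m f"
    by (metis Mp_Mp degree_m_smult_le)
  then have "degree ?s = degree_m f" using co le_degree[of ?s "degree_m f"] by simp
  with co have "monic ?s" "degree ?s = degree_m f" by simp_all
  then show ?thesis by (intro that[of ?s c]) simp_all
qed

text \<open>The witness \<open>d\<close> has least degree among the monic polynomials in the ideal
  generated by \<open>f\<close> and \<open>g\<close> modulo \<open>p\<close>; the monic
  \<open>f\<close> shows that there are any.\<close>

lemma bezout_mod:
  assumes "monic f"
  obtains d u v where "monic d" "d dvdm f" "d dvdm g" "Mp d = Mp (u * f + v * g)"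
proof -
  define J where "J = {h. monic h \<and> (\<exists>u v. Mp h = Mp (u * f + v * g))}"
  have "Mp f = Mp (1 * f + 0 * g)" by simp
  then have "f \<in> J" using assms unfolding J_def by blast
  then obtain d where d: "d \<in> J" and min: "\<And>h. h \<in> J \<Longrightarrow> degree d \<le> degree h"
    using ex_has_least_nat[of "\<lambda>h. h \<in> J" f degree] by blast
  obtain u v where uv: "Mp d = Mp (u * f + v * g)" and mon: "monic d" using d by (auto simp: J_def)
  \<comment> \<open>A remainder that is nonzero modulo \<open>p\<close> could be made monic and
    would contradict minimality. The claim covers all combinations, so that \<open>f\<close> and
    \<open>g\<close> are the instances with coefficients \<open>(1, 0)\<close> and
    \<open>(0, 1)\<close>.\<close>
  have dvd: "d dvdm h" if "h = a * f + b * g" for h a b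
  proof -
    obtain q r where qr: "h = d * q + r" "r = 0 \<or> degree r < degree d"
      using monic_division[OF mon] by blast
    have r: "Mp r = Mp ((a - q * u) * f + (b - q * v) * g)"
    proof -
      have "Mp r = Mp (h - d * q)" using qr by simp
      also have "\<dots> = Mp (a * f + b * g - (u * f + v * g) * q)"
        unfolding that by (intro Mp_diff_cong Mp_mult_cong uv refl)
      finally show ?thesis by (simp add: algebra_simps)
    qed
    have "Mp r = 0"
    proof (rule ccontr)
      assume r0: "Mp r \<noteq> 0"
      from make_monic_mod[OF this] obtain c s
        where s: "monic s" "degree s = degree_m r" "Mp s = Mp (smult c r)" by metis
      have "Mp s = Mp (smult c (Mp r))" using s by simp
      also have "\<dots> = Mp (smult c ((a - q * u) * f + (b - q * v) * g))" unfolding r by simp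
      also have "\<dots> = Mp (smult c (a - q * u) * f + smult c (b - q * v) * g)"
        by (simp add: smult_add_right)
      finally have "s \<in> J" using s(1) unfolding J_def by blast
      then have "degree d \<le> degree_m r" using min s(2) by metis
      then have "degree d \<le> degree r" using degree_m_le[of r] by linarith
      with qr r0 show False by auto
    qed
    then have "Mp h = Mp (d * q)" using qr Mp_add_cong[of "d * q" "d * q" r 0] by simp
    then show ?thesis unfolding dvdm_def by blast
  qed
  show ?thesis
    by (rule that[OF mon dvd[of f 1 0] dvd[of g 0 1] uv]) simp_all
qed

text \<open>Take the common divisor \<open>d\<close> of \<open>g\<close> and \<open>a\<close> from
  Bezout's identity and write \<open>g = d * e\<close> modulo \<open>p\<close>. If \<open>d\<close>
  is a unit, multiplying the identity by \<open>b\<close> exhibits \<open>b\<close> as a combination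
  of \<open>g\<close> and \<open>a * b\<close>. If \<open>e\<close> is a unit, \<open>g\<close>
  divides \<open>d\<close> and hence \<open>a\<close>.\<close>

lemma irreducible_m_dvdm_mult:
  assumes irr: "irreducible_m g" and mon: "monic g" and dvd: "g dvdm a * b"
  shows "g dvdm a \<or> g dvdm b"
proof -
  obtain d u v where d: "d dvdm g" "d dvdm a" "Mp d = Mp (u * g + v * a)"
    using bezout_mod[OF mon, of a] by metis
  from d(1) obtain e where e: "Mp g = Mp (d * e)" by (auto simp: dvdm_def)
  with irr have "d dvdm 1 \<or> e dvdm 1" by (auto simp: irreducible_m_def)
  then show ?thesis
  proof
    assume "d dvdm 1"
    then obtain w where w: "Mp 1 = Mp (d * w)" by (auto simp: dvdm_def)
    have "Mp (1 * b) = Mp (d * w * b)" using w by (rule Mp_mult_cong) simp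
    also have "\<dots> = Mp ((u * g + v * a) * (w * b))"
      unfolding mult.assoc using d(3) by (rule Mp_mult_cong) simp
    also have "(u * g + v * a) * (w * b) = g * (u * w * b) + v * w * (a * b)"
      by (simp add: algebra_simps)
    finally have eq: "Mp b = Mp (g * (u * w * b) + v * w * (a * b))" by simp
    have "g dvdm g * (u * w * b) + v * w * (a * b)"
      by (intro dvdm_add dvdm_mult_left dvd dvd_imp_dvdm) simp
    then show ?thesis using eq dvdm_cong by blast
  next
    assume "e dvdm 1"
    then obtain w where w: "Mp 1 = Mp (e * w)" by (auto simp: dvdm_def)
    have "Mp (g * w) = Mp (d * e * w)" using e by (rule Mp_mult_cong) simp
    also have "\<dots> = Mp (d * 1)" unfolding mult.assoc by (rule Mp_mult_cong) (simp_all only: w)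
    finally have "g dvdm d" unfolding dvdm_def by (metis mult.right_neutral)
    then show ?thesis using d(2) dvdm_trans by blast
  qed
qed

section \<open>Monic irreducibles and unique factorization\<close>

definition monic_irreducibles :: "int poly set" where
  "monic_irreducibles = {g. Mp g = g \<and> monic g \<and> irreducible_m g}"

definition reduced_monic :: "nat \<Rightarrow> int poly set" where
  "reduced_monic n = {f. Mp f = f \<and> monic f \<and> degree f = n}"

lemma Mp_in_reduced_monic: "monic f \<Longrightarrow> Mp f \<in> reduced_monic (degree f)"
  by (simp add: reduced_monic_def Mp_coeff)

lemma monic_irreducibles_degree_pos:
  assumes "g \<in> monic_irreducibles"
  shows "degree g > 0"
proof (rule ccontr)
  assume "\<not> degree g > 0"
  then have "g = 1" using assms by (auto simp: monic_irreducibles_def elim!: degree_eq_zeroE)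
  then show False using assms dvdm_refl by (auto simp: monic_irreducibles_def irreducible_m_def)
qed

text \<open>The cofactor \<open>e\<close> is a unit, so \<open>g\<close> and \<open>h\<close> divide
  each other and have equal degree. This makes \<open>e\<close> constant modulo \<open>p\<close>,
  and comparing leading coefficients makes the constant 1.\<close>

lemma monic_irreducibles_dvdm_imp_eq:
  assumes "g \<in> monic_irreducibles" "h \<in> monic_irreducibles" "g dvdm h"
  shows "g = h"
proof -
  obtain e where e: "Mp h = Mp (g * e)" using assms(3) by (auto simp: dvdm_def)
  have "g dvdm 1 \<or> e dvdm 1" using assms(2) e by (auto simp: monic_irreducibles_def irreducible_m_def)
  moreover have "\<not> g dvdm 1" using assms(1) by (auto simp: monic_irreducibles_def irreducible_m_def)
  ultimately obtain w where w: "Mp 1 = Mp (e * w)" by (auto simp: dvdm_def)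
  have "Mp (h * w) = Mp (g * e * w)" using e by (rule Mp_mult_cong) simp
  also have "\<dots> = Mp (g * 1)" unfolding mult.assoc by (rule Mp_mult_cong) (simp_all only: w)
  finally have "h dvdm g" unfolding dvdm_def by (metis mult.right_neutral)
  have mon: "monic g" "monic h" "Mp g = g" "Mp h = h" using assms by (auto simp: monic_irreducibles_def)
  then have "g \<noteq> 0" "h \<noteq> 0" by auto
  then have deg: "degree g = degree h"
    using dvdm_degree[OF mon(1) assms(3)] dvdm_degree[OF mon(2) \<open>h dvdm g\<close>] mon by simp
  have "Mp e \<noteq> 0" using e mon \<open>h \<noteq> 0\<close> by (metis Mp_0 mult_Mp(2) mult_zero_right)
  then have "degree h = degree g + degree_m e" using degree_Mp_monic_mult[OF mon(1)] e mon(4) by metis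
  then have "degree_m e = 0" using deg by simp
  then obtain c where c: "Mp e = [:c:]" by (rule degree_eq_zeroE)
  have "h = Mp (smult c g)" using e mon(4) mult_Mp(2)[of g e] by (simp add: c)
  moreover have "coeff (Mp (smult c g)) (degree g) = M c" by (simp add: Mp_coeff mon(1))
  ultimately have "M c = 1" using deg mon(2) by simp
  then have "Mp (smult c g) = Mp (smult 1 g)" by (metis M_1 Mp_smult(1))
  with \<open>h = Mp (smult c g)\<close> mon(3) show ?thesis by simp
qed

lemma monic_prod_mset_irreducibles:
  assumes "set_mset Q \<subseteq> monic_irreducibles"
  shows "monic (prod_mset Q)" "degree (prod_mset Q) = (\<Sum>g\<in>#Q. degree g)"
proof -
  have "monic (prod_mset Q) \<and> degree (prod_mset Q) = (\<Sum>g\<in>#Q. degree g)"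
    using assms
  proof (induction Q)
    case (add g Q)
    then have "monic g" "monic (prod_mset Q)" by (auto simp: monic_irreducibles_def)
    moreover from this have "degree (g * prod_mset Q) = degree g + degree (prod_mset Q)"
      by (rule degree_mult_monic)
    ultimately show ?case using add monic_mult[of g "prod_mset Q"] by simp
  qed simp
  then show "monic (prod_mset Q)" "degree (prod_mset Q) = (\<Sum>g\<in>#Q. degree g)" by blast+
qed

lemma irreducible_dvdm_prod_mset:
  assumes "g \<in> monic_irreducibles" "set_mset Q \<subseteq> monic_irreducibles" "g dvdm prod_mset Q"
  shows "g \<in># Q"
  using assms(2,3)
proof (induction Q)
  case empty
  then show ?case using assms(1) by (auto simp: monic_irreducibles_def irreducible_m_def)
next
  case (add h Q)
  then have "g dvdm h \<or> g dvdm prod_mset Q"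
    using assms(1) irreducible_m_dvdm_mult[of g h "prod_mset Q"] by (auto simp: monic_irreducibles_def)
  then show ?case using add monic_irreducibles_dvdm_imp_eq[OF assms(1), of h] by auto
qed

lemma dvdm_prod_mset_iff:
  assumes "g \<in> monic_irreducibles" "set_mset Q \<subseteq> monic_irreducibles"
  shows "g dvdm prod_mset Q \<longleftrightarrow> g \<in># Q"
  using irreducible_dvdm_prod_mset[OF assms] by (auto intro: dvd_imp_dvdm dvd_prod_mset)

lemma prod_mset_irreducibles_inj:
  assumes "set_mset Q \<subseteq> monic_irreducibles" "set_mset R \<subseteq> monic_irreducibles"
    and "Mp (prod_mset Q) = Mp (prod_mset R)"
  shows "Q = R"
  using assms
proof (induction Q arbitrary: R)
  case empty
  show ?case
  proof (rule ccontr)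
    assume "{#} \<noteq> R"
    then obtain g R' where R: "R = add_mset g R'" by (metis multiset_nonemptyE multi_member_split)
    then have "g dvdm prod_mset R" by (auto intro: dvd_imp_dvdm)
    then have "g dvdm 1" using empty.prems(3) dvdm_cong[of g g 1 "prod_mset R"] by simp
    then show False using empty.prems(2) R by (auto simp: monic_irreducibles_def irreducible_m_def)
  qed
next
  case (add g Q)
  have g: "g \<in> monic_irreducibles" using add.prems(1) by simp
  have "g dvdm prod_mset (add_mset g Q)" by (auto intro: dvd_imp_dvdm)
  then have "g dvdm prod_mset R" using add.prems(3) dvdm_cong by blast
  then have "g \<in># R" using irreducible_dvdm_prod_mset[OF g add.prems(2)] by simp
  then obtain R' where R: "R = add_mset g R'" by (metis multi_member_split)
  have "Mp (g * prod_mset Q) = Mp (g * prod_mset R')" using add.prems(3) R by simp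
  moreover have "monic g" using g by (simp add: monic_irreducibles_def)
  ultimately have "Mp (prod_mset Q) = Mp (prod_mset R')" using monic_mult_cancel_mod by blast
  then show ?case using add.IH[of R'] add.prems R by simp
qed

text \<open>Strong induction on the degree. The factors of a reducible \<open>f\<close> need not be
  monic, so they are scaled to monic \<open>s\<close> and \<open>t\<close> before the induction
  hypothesis is applied.\<close>

lemma reduced_monic_factorization:
  assumes "f \<in> reduced_monic n"
  shows "\<exists>Q. set_mset Q \<subseteq> monic_irreducibles \<and> Mp (prod_mset Q) = f"
  using assms
proof (induction n arbitrary: f rule: less_induct)
  case (less n)
  have f: "Mp f = f" "monic f" "degree f = n" using less.prems by (auto simp: reduced_monic_def)
  consider "n = 0" | "irreducible_m f" | "n > 0" "\<not> irreducible_m f" by auto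
  then show ?case
  proof cases
    case 1
    then have "f = 1" using f by (auto elim!: degree_eq_zeroE)
    then show ?thesis by (intro exI[of _ "{#}"]) simp
  next
    case 2
    then show ?thesis using f by (intro exI[of _ "{#f#}"]) (auto simp: monic_irreducibles_def)
  next
    case 3
    have "f \<noteq> 0" using f by auto
    moreover have "\<not> f dvdm 1" using monic_dvdm_1D[OF f(2)] 3(1) f(3) by auto
    ultimately obtain a b where ab: "Mp f = Mp (a * b)" "\<not> a dvdm 1" "\<not> b dvdm 1"
      using 3(2) f(1) by (auto simp: irreducible_m_def)
    have "Mp a \<noteq> 0" using ab(1) f(1) \<open>f \<noteq> 0\<close> by (metis Mp_0 mult_Mp(1) mult_zero_left)
    from make_monic_mod[OF this] obtain c s where
      s: "monic s" "degree s = degree_m a" "Mp s = Mp (smult c a)" by metis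
    have "Mp b \<noteq> 0" using ab(1) f(1) \<open>f \<noteq> 0\<close> by (metis Mp_0 mult_Mp(2) mult_zero_right)
    from make_monic_mod[OF this] obtain e t where
      t: "monic t" "degree t = degree_m b" "Mp t = Mp (smult e b)" by metis
    have deg: "n = degree s + degree t"
      using degree_m_eq_prime[of f a b] ab(1) f prime s(2) t(2) \<open>f \<noteq> 0\<close> by simp
    have eq: "Mp (s * t) = Mp (smult (c * e) f)"
    proof -
      have "Mp (s * t) = Mp (smult c a * smult e b)" by (rule Mp_mult_cong) fact+
      also have "\<dots> = Mp (smult (c * e) (Mp (a * b)))" by (simp add: mult.commute)
      also have "\<dots> = Mp (smult (c * e) f)" using ab(1) by (metis Mp_smult(2))
      finally show ?thesis .
    qed
    \<comment> \<open>Both \<open>s * t\<close> and \<open>f\<close> are monic of degree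
      \<open>n\<close>, so the accumulated scalar \<open>c * e\<close> must be 1 modulo
      \<open>p\<close>.\<close>
    have "monic (s * t)" "degree (s * t) = n" using s(1) t(1) deg degree_mult_monic[of s t] monic_mult[of s t] by auto
    then have "coeff (Mp (s * t)) n = 1" by (metis M_1 Mp_coeff)
    then have "M (c * e) = 1" using f by (simp add: eq Mp_coeff)
    then have st: "Mp (s * t) = f" using eq f(1) by (metis M_1 Mp_smult(1) smult_1_left)
    \<comment> \<open>A monic multiple of degree 0 would exhibit an inverse of \<open>h\<close>.
      Hence both scaled factors have positive degree, and so degree less than
      \<open>n\<close>.\<close>
    have nonunit: "degree g > 0" if "monic g" "Mp g = Mp (smult k h)" "\<not> h dvdm 1" for g h k
    proof (rule ccontr)
      assume "\<not> degree g > 0"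
      then have "g = 1" using that(1) by (auto elim!: degree_eq_zeroE)
      then have "Mp 1 = Mp (h * [:k:])" using that(2) by simp
      then show False using that(3) unfolding dvdm_def by blast
    qed
    have "degree s > 0" "degree t > 0" using nonunit s t ab by blast+
    then have lt: "degree s < n" "degree t < n" using deg by simp_all
    have "Mp s \<in> reduced_monic (degree s)" "Mp t \<in> reduced_monic (degree t)"
      using s(1) t(1) by (simp_all add: Mp_in_reduced_monic)
    with less.IH lt obtain Q R where
      QR: "set_mset Q \<subseteq> monic_irreducibles" "Mp (prod_mset Q) = Mp s"
        "set_mset R \<subseteq> monic_irreducibles" "Mp (prod_mset R) = Mp t" by metis
    have "Mp (prod_mset (Q + R)) = Mp (s * t)" using Mp_mult_cong[OF QR(2,4)] by simp
    then show ?thesis using QR st by (intro exI[of _ "Q + R"]) auto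
  qed
qed

lemma bij_betw_prod_mset_reduced_monic:
  "bij_betw (\<lambda>Q. Mp (prod_mset Q))
     {Q. set_mset Q \<subseteq> monic_irreducibles \<and> (\<Sum>g\<in>#Q. degree g) = n} (reduced_monic n)"
  unfolding bij_betw_def
proof
  show "inj_on (\<lambda>Q. Mp (prod_mset Q))
      {Q. set_mset Q \<subseteq> monic_irreducibles \<and> (\<Sum>g\<in>#Q. degree g) = n}"
    by (auto simp: inj_on_def intro: prod_mset_irreducibles_inj)
  show "(\<lambda>Q. Mp (prod_mset Q))
      ` {Q. set_mset Q \<subseteq> monic_irreducibles \<and> (\<Sum>g\<in>#Q. degree g) = n} = reduced_monic n"
  proof (intro equalityI subsetI)
    fix f assume "f \<in> (\<lambda>Q. Mp (prod_mset Q))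
      ` {Q. set_mset Q \<subseteq> monic_irreducibles \<and> (\<Sum>g\<in>#Q. degree g) = n}"
    then show "f \<in> reduced_monic n"
      using monic_prod_mset_irreducibles by (auto simp: reduced_monic_def Mp_coeff)
  next
    fix f assume f: "f \<in> reduced_monic n"
    then obtain Q where Q: "set_mset Q \<subseteq> monic_irreducibles" "Mp (prod_mset Q) = f"
      using reduced_monic_factorization by blast
    then have "(\<Sum>g\<in>#Q. degree g) = n"
      using monic_prod_mset_irreducibles[OF Q(1)] f by (auto simp: reduced_monic_def)
    with Q show "f \<in> (\<lambda>Q. Mp (prod_mset Q))
      ` {Q. set_mset Q \<subseteq> monic_irreducibles \<and> (\<Sum>g\<in>#Q. degree g) = n}" by blast
  qed
qed

end

section \<open>Discriminants modulo a prime\<close>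

text \<open>The polynomial whose coefficients, from the highest power down, form row
  \<open>i\<close> of the Sylvester matrix. In this form a combination of rows is visibly of the
  shape \<open>u * f + v * g\<close>.\<close>

definition sylvester_row :: "'a :: comm_ring_1 poly \<Rightarrow> 'a poly \<Rightarrow> nat \<Rightarrow> 'a poly" where
  "sylvester_row f g i =
     (if i < degree g then monom 1 (degree g - 1 - i) * f
      else monom 1 (degree f + degree g - 1 - i) * g)"

lemma sylvester_mat_eq_coeff_row:
  assumes "i < degree f + degree g" "j < degree f + degree g"
  shows "sylvester_mat f g $$ (i, j) = coeff (sylvester_row f g i) (degree f + degree g - 1 - j)"
  using assms
  by (auto simp: sylvester_index_mat2 sylvester_row_def coeff_monom_mult split: if_splits
      intro!: arg_cong[of _ _ "coeff _"])

lemma coeff_sylvester_row_eq_0: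
  assumes "i < degree f + degree g" "k \<ge> degree f + degree g"
  shows "coeff (sylvester_row f g i) k = 0"
  using assms by (auto simp: sylvester_row_def coeff_monom_mult intro!: coeff_eq_0)

lemma sum_lessThan_add_nat:
  fixes h :: "nat \<Rightarrow> 'a :: comm_monoid_add"
  shows "(\<Sum>i<n + m. h i) = (\<Sum>i<n. h i) + (\<Sum>i<m. h (n + i))"
  by (induction m) (simp_all add: add.assoc)

lemma sum_sylvester_rows:
  fixes f g :: "'a :: comm_ring_1 poly"
  shows "(\<Sum>i<degree f + degree g. smult (c i) (sylvester_row f g i))
    = (\<Sum>i<degree g. monom (c i) (degree g - 1 - i)) * f
      + (\<Sum>i<degree f. monom (c (degree g + i)) (degree f - 1 - i)) * g"
proof -
  have "smult a (monom 1 k * h) = monom a k * h" for a k and h :: "'a poly"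
    by (metis mult_smult_left smult_monom mult.right_neutral)
  then have row: "smult (c i) (sylvester_row f g i)
      = (if i < degree g then monom (c i) (degree g - 1 - i) * f
         else monom (c i) (degree f + degree g - 1 - i) * g)" for i
    by (simp add: sylvester_row_def)
  show ?thesis
    unfolding row by (simp add: add.commute[of "degree f"] sum_lessThan_add_nat sum_distrib_right)
qed

text \<open>The product of the adjugate with the Sylvester matrix is the determinant times the
  identity, so each row of the adjugate combines the Sylvester rows to a multiple of a unit
  vector.\<close>

lemma resultant_eq_combination:
  fixes f g :: "'a :: comm_ring_1 poly"
  assumes "degree f + degree g > 0"
  obtains u v where "[:resultant f g:] = u * f + v * g"
proof -
  let ?N = "degree f + degree g" and ?S = "sylvester_mat f g"
  have S: "?S \<in> carrier_mat ?N ?N" by auto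
  note adj = adj_mat[OF S]
  \<comment> \<open>The last row is taken because the last column of the Sylvester matrix holds the
    constant coefficients.\<close>
  define c where "c i = adj_mat ?S $$ (?N - 1, i)" for i
  have "(\<Sum>i<?N. smult (c i) (sylvester_row f g i)) = [:resultant f g:]"
  proof (rule poly_eqI)
    fix k
    show "coeff (\<Sum>i<?N. smult (c i) (sylvester_row f g i)) k = coeff [:resultant f g:] k"
    proof (cases "k < ?N")
      case True
      define j where "j = ?N - 1 - k"
      have j: "j < ?N" "k = ?N - 1 - j" using True by (auto simp: j_def)
      have "coeff (\<Sum>i<?N. smult (c i) (sylvester_row f g i)) k = (\<Sum>i<?N. c i * ?S $$ (i, j))"
        unfolding coeff_sum j(2) using sylvester_mat_eq_coeff_row[OF _ j(1)] by simp
      also have "\<dots> = (adj_mat ?S * ?S) $$ (?N - 1, j)"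
        using assms j(1) adj(1) S
        by (simp add: scalar_prod_def c_def lessThan_atLeast0)
      also have "\<dots> = det ?S * (if ?N - 1 = j then 1 else 0)"
        unfolding adj(3) using assms j(1) by simp
      also have "\<dots> = coeff [:resultant f g:] k"
        using assms j by (auto simp: resultant_def coeff_pCons split: nat.splits)
      finally show ?thesis .
    next
      case False
      then show ?thesis using assms
        by (auto simp: coeff_sum coeff_sylvester_row_eq_0 coeff_pCons split: nat.splits)
    qed
  qed
  then show ?thesis using that unfolding sum_sylvester_rows by metis
qed

lemma sum_monom_rev:
  assumes "\<And>i. i \<ge> n \<Longrightarrow> coeff a i = 0"
  shows "(\<Sum>i<n. monom (coeff a (n - 1 - i)) (n - 1 - i)) = a"
proof -
  have "(\<Sum>i<n. monom (coeff a (n - 1 - i)) (n - 1 - i)) = (\<Sum>i<n. monom (coeff a i) i)"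
    using sum.nat_diff_reindex[of "\<lambda>i. monom (coeff a i) i" n] by simp
  also have "\<dots> = a"
    using assms by (auto simp: poly_eq_iff coeff_sum if_distrib cong: if_cong)
  finally show ?thesis .
qed

lemma det_cong_mod:
  fixes A B :: "int mat"
  assumes "A \<in> carrier_mat n n" "B \<in> carrier_mat n n"
    and "\<And>i j. i < n \<Longrightarrow> j < n \<Longrightarrow> [A $$ (i, j) = B $$ (i, j)] (mod m)"
  shows "[det A = det B] (mod m)"
  unfolding det_def'[OF assms(1)] det_def'[OF assms(2)]
proof (intro cong_sum cong_mult cong_prod cong_refl)
  fix q i assume "q \<in> {q. q permutes {0..<n}}" "i \<in> {0..<n}"
  then show "[A $$ (i, q i) = B $$ (i, q i)] (mod m)"
    using assms(3) permutes_in_image[of q "{0..<n}" i] by auto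
qed

section \<open>Resultants and common factors modulo a prime\<close>

context poly_mod_prime
begin

lemma Mp_cong_coeff: "Mp f = Mp g \<longleftrightarrow> (\<forall>k. [coeff f k = coeff g k] (mod p))"
  by (simp add: poly_eq_iff Mp_coeff M_def cong_def)

text \<open>Multiply Bezout's identity by \<open>monom 1 k\<close>, reduce the cofactor of
  \<open>g\<close> modulo \<open>f\<close> and move the quotient into the cofactor \<open>a\<close>
  of \<open>f\<close>. Then \<open>a * f\<close> agrees modulo \<open>p\<close> with
  \<open>monom 1 k - r * g\<close>, whose degree is small, and since \<open>f\<close> is monic this
  bounds the degree of \<open>a\<close> modulo \<open>p\<close>.\<close>

lemma monom_combination_mod:
  assumes mon: "monic f" and deg: "degree f > 0" and k: "k < degree f + degree g"
    and uv: "Mp 1 = Mp (u * f + v * g)"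
  obtains a b where "\<And>i. i \<ge> degree g \<Longrightarrow> coeff a i = 0" "\<And>i. i \<ge> degree f \<Longrightarrow> coeff b i = 0"
    "Mp (a * f + b * g) = Mp (monom 1 k)"
proof -
  obtain q r where qr: "v * monom 1 k = f * q + r" "r = 0 \<or> degree r < degree f"
    using monic_division[OF mon] by metis
  define a where "a = u * monom 1 k + q * g"
  have "Mp (1 * monom 1 k) = Mp ((u * f + v * g) * monom 1 k)" by (rule Mp_mult_cong[OF uv refl])
  also have "(u * f + v * g) * monom 1 k = u * f * monom 1 k + (v * monom 1 k) * g"
    by (simp add: algebra_simps)
  also have "\<dots> = a * f + r * g" unfolding qr a_def by (simp add: algebra_simps)
  finally have eq: "Mp (monom 1 k) = Mp (a * f + r * g)" by simp
  then have "Mp (monom 1 k - r * g) = Mp (a * f + r * g - r * g)" by (rule Mp_diff_cong) simp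
  then have af: "Mp (f * a) = Mp (monom 1 k - r * g)" by (simp add: mult.commute)
  have "degree (r * g) < degree f + degree g"
    using qr(2) deg degree_mult_le[of r g] by auto
  moreover have "degree (monom (1 :: int) k) < degree f + degree g" using k by (simp add: degree_monom_eq)
  ultimately have "degree (monom 1 k - r * g) < degree f + degree g" by (simp add: degree_diff_less)
  then have lt: "degree_m (f * a) < degree f + degree g"
    unfolding af using degree_m_le[of "monom 1 k - r * g"] by linarith
  have "coeff (Mp a) i = 0" if "i \<ge> degree g" for i
  proof (cases "Mp a = 0")
    case False
    from degree_Mp_monic_mult[OF mon False] lt have "degree_m a < degree g" by simp
    then show ?thesis using that by (intro coeff_eq_0) simp
  qed simp
  moreover have "coeff r i = 0" if "i \<ge> degree f" for i
    using qr(2) that by (auto intro: coeff_eq_0)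
  \<comment> \<open>The degree bound holds for the reduction of \<open>a\<close>; the higher
    coefficients of \<open>a\<close> itself may be nonzero multiples of \<open>p\<close>.\<close>
  moreover have "Mp (Mp a * f + r * g) = Mp (monom 1 k)"
    unfolding eq by (intro Mp_add_cong) simp_all
  ultimately show ?thesis by (rule that)
qed

text \<open>The coefficients of the combinations that represent the monomials modulo \<open>p\<close> form a matrix
  which is inverse to the Sylvester matrix modulo \<open>p\<close>.\<close>

lemma bezout_imp_not_dvd_resultant:
  assumes mon: "monic f" and deg: "degree f > 0" and uv: "Mp 1 = Mp (u * f + v * g)"
  shows "\<not> p dvd resultant f g"
proof -
  let ?m = "degree f" and ?n = "degree g" and ?S = "sylvester_mat f g"
  let ?N = "?m + ?n"
  have S: "?S \<in> carrier_mat ?N ?N" by auto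
  have "\<exists>a b. (\<forall>i\<ge>?n. coeff a i = 0) \<and> (\<forall>i\<ge>?m. coeff b i = 0)
      \<and> Mp (a * f + b * g) = Mp (monom 1 k)" if "k < ?N" for k
    using monom_combination_mod[OF mon deg that uv] by metis
  then obtain a b where a: "\<And>k i. k < ?N \<Longrightarrow> i \<ge> ?n \<Longrightarrow> coeff (a k) i = 0"
    and b: "\<And>k i. k < ?N \<Longrightarrow> i \<ge> ?m \<Longrightarrow> coeff (b k) i = 0"
    and ab: "\<And>k. k < ?N \<Longrightarrow> Mp (a k * f + b k * g) = Mp (monom 1 k)"
    by metis
  \<comment> \<open>Sylvester columns run from the highest power down. Row \<open>k\<close>
    therefore represents the monomial of degree \<open>?N - 1 - k\<close>, so that the product is
    the identity and not its reversal.\<close>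
  define c where "c k i = (if i < ?n then coeff (a (?N - 1 - k)) (?n - 1 - i)
      else coeff (b (?N - 1 - k)) (?N - 1 - i))" for k i
  define U where "U = mat ?N ?N (\<lambda>(k, i). c k i)"
  have U: "U \<in> carrier_mat ?N ?N" by (simp add: U_def)
  have "[(U * ?S) $$ (k, j) = 1\<^sub>m ?N $$ (k, j)] (mod p)" if kj: "k < ?N" "j < ?N" for k j
  proof -
    let ?k = "?N - 1 - k"
    have k: "?k < ?N" using kj by simp
    have "(\<Sum>i<?N. smult (c k i) (sylvester_row f g i))
        = (\<Sum>i<?n. monom (coeff (a ?k) (?n - 1 - i)) (?n - 1 - i)) * f
          + (\<Sum>i<?m. monom (coeff (b ?k) (?m - 1 - i)) (?m - 1 - i)) * g"
      unfolding sum_sylvester_rows by (simp add: c_def)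
    also have "\<dots> = a ?k * f + b ?k * g"
      using a[OF k] b[OF k] by (simp only: sum_monom_rev)
    finally have comb: "(\<Sum>i<?N. smult (c k i) (sylvester_row f g i)) = a ?k * f + b ?k * g" .
    have "(U * ?S) $$ (k, j) = (\<Sum>i<?N. c k i * ?S $$ (i, j))"
      using kj S U by (simp add: scalar_prod_def lessThan_atLeast0 U_def)
    also have "\<dots> = coeff (\<Sum>i<?N. smult (c k i) (sylvester_row f g i)) (?N - 1 - j)"
      using sylvester_mat_eq_coeff_row[OF _ kj(2)] by (simp add: coeff_sum)
    also have "[\<dots> = coeff (monom 1 ?k) (?N - 1 - j)] (mod p)"
      unfolding comb using ab[OF k] Mp_cong_coeff by blast
    also have "coeff (monom 1 ?k) (?N - 1 - j) = 1\<^sub>m ?N $$ (k, j)" using kj by auto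
    finally show ?thesis .
  qed
  then have "[det (U * ?S) = det (1\<^sub>m ?N :: int mat)] (mod p)"
    using S U by (intro det_cong_mod[of _ ?N]) auto
  then have "[det U * resultant f g = 1] (mod p)" using det_mult[OF U S] by (simp add: resultant_def)
  then show ?thesis using m1 by (auto simp: cong_def elim!: dvdE)
qed

text \<open>If the common divisor from Bezout's identity is 1, the resultant is a unit modulo
  \<open>p\<close>; conversely, a common divisor of positive degree divides the constant
  \<open>resultant f g\<close>. The degree of \<open>g\<close> may drop modulo \<open>p\<close>,
  which matters for \<open>g = pderiv f\<close>.\<close>

lemma dvd_resultant_iff:
  assumes mon: "monic f" and deg: "degree f > 0"
  shows "p dvd resultant f g \<longleftrightarrow> (\<exists>d. monic d \<and> degree d > 0 \<and> d dvdm f \<and> d dvdm g)"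
proof
  assume dvd: "p dvd resultant f g"
  obtain d u v where d: "monic d" "d dvdm f" "d dvdm g" "Mp d = Mp (u * f + v * g)"
    using bezout_mod[OF mon] by metis
  have "degree d > 0"
  proof (rule ccontr)
    assume "\<not> degree d > 0"
    then have "d = 1" using d(1) by (auto elim!: degree_eq_zeroE)
    then show False using bezout_imp_not_dvd_resultant[OF mon deg] d(4) dvd by blast
  qed
  with d show "\<exists>d. monic d \<and> degree d > 0 \<and> d dvdm f \<and> d dvdm g" by blast
next
  assume "\<exists>d. monic d \<and> degree d > 0 \<and> d dvdm f \<and> d dvdm g"
  then obtain d where d: "monic d" "degree d > 0" "d dvdm f" "d dvdm g" by blast
  obtain u v where "[:resultant f g:] = u * f + v * g"
    using resultant_eq_combination[of f g] deg by auto
  moreover have "d dvdm u * f + v * g" using d by (intro dvdm_add dvdm_mult_left)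
  ultimately have "d dvdm [:resultant f g:]" by simp
  from monic_dvdm_constant[OF this d(1,2)] show "p dvd resultant f g" by auto
qed

end

section \<open>The Frobenius map and derivatives of irreducibles\<close>

lemma prime_dvd_add_power_prime:
  fixes a b :: "'a :: comm_ring_1"
  assumes "prime P"
  shows "of_nat P dvd (a + b) ^ P - (a ^ P + b ^ P)"
proof -
  have P: "P \<noteq> 0" "P > 0" using assms prime_gt_0_nat by auto
  let ?t = "\<lambda>k. of_nat (P choose k) * a ^ k * b ^ (P - k)"
  \<comment> \<open>The two outer terms are \<open>b ^ P\<close> and \<open>a ^ P\<close>; all other
    binomial coefficients are divisible by \<open>P\<close>.\<close>
  have "{..P} = insert 0 (insert P {1..<P})" using P by auto
  then have "(a + b) ^ P = ?t 0 + (?t P + sum ?t {1..<P})"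
    unfolding binomial_ring using P by simp
  then have "(a + b) ^ P - (a ^ P + b ^ P) = sum ?t {1..<P}" by simp
  also have "of_nat P dvd \<dots>"
  proof (rule dvd_sum)
    fix k assume "k \<in> {1..<P}"
    then have "P dvd P choose k" using assms by (intro dvd_choose_prime) auto
    then have "of_nat P dvd (of_nat (P choose k) :: 'a)" by (auto elim!: dvdE)
    then show "of_nat P dvd ?t k" by (simp add: mult.assoc)
  qed
  finally show ?thesis .
qed

context poly_mod_prime
begin

lemma nat_p: "prime (nat p)" "int (nat p) = p" "nat p \<ge> 2"
proof -
  show "prime (nat p)" "int (nat p) = p" using prime prime_gt_0_int[of p] by auto
  then show "nat p \<ge> 2" by (intro prime_ge_2_nat)
qed

lemma Mp_add_power_p: "Mp ((a + b) ^ nat p) = Mp (a ^ nat p + b ^ nat p)"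
  using prime_dvd_add_power_prime[OF nat_p(1), of a b] nat_p(2)
  by (simp add: Mp_eq_iff_dvd of_nat_poly)

lemma Mp_sum_cong:
  assumes "\<And>i. i \<in> A \<Longrightarrow> Mp (h i) = Mp (k i)"
  shows "Mp (sum h A) = Mp (sum k A)"
  using assms by (induction A rule: infinite_finite_induct) (auto intro: Mp_add_cong)

lemma Mp_sum_power_p:
  assumes "finite A"
  shows "Mp ((\<Sum>i\<in>A. h i) ^ nat p) = Mp (\<Sum>i\<in>A. h i ^ nat p)"
  using assms
proof (induction A rule: finite_induct)
  case empty
  then show ?case using nat_p(3) by (simp add: zero_power)
next
  case (insert x A)
  have "Mp ((\<Sum>i\<in>insert x A. h i) ^ nat p) = Mp (h x ^ nat p + (\<Sum>i\<in>A. h i) ^ nat p)"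
    using insert by (simp add: Mp_add_power_p)
  also have "\<dots> = Mp (h x ^ nat p + (\<Sum>i\<in>A. h i ^ nat p))"
    by (rule Mp_add_cong[OF refl insert.IH])
  finally show ?case using insert by simp
qed

text \<open>Fermat's little theorem, by induction on \<open>c\<close> from the additivity of
  \<open>p\<close>-th powers modulo \<open>p\<close>.\<close>

lemma power_p_mod:
  assumes "c \<ge> 0"
  shows "M (c ^ nat p) = M c"
proof -
  have "M (int k ^ nat p) = M (int k)" for k
  proof (induction k)
    case 0
    then show ?case using nat_p(3) by (simp add: zero_power)
  next
    case (Suc k)
    have "p dvd (int k + 1) ^ nat p - (int k ^ nat p + 1)"
      using prime_dvd_add_power_prime[OF nat_p(1), of "int k" 1] nat_p(2) by simp
    then have "M ((int k + 1) ^ nat p) = M (int k ^ nat p + 1)"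
      by (simp add: M_def mod_eq_dvd_iff)
    also have "\<dots> = M (int k + 1)" using Suc by (metis M_plus(1))
    finally show ?case by (simp add: add.commute)
  qed
  from this[of "nat c"] assms show ?thesis by simp
qed

lemma Mp_pderiv_cong:
  assumes "Mp f = Mp g"
  shows "Mp (pderiv f) = Mp (pderiv g)"
proof -
  from assms obtain h where "f - g = [:p:] * h" by (auto simp: Mp_eq_iff_dvd elim: dvdE)
  then have "f = g + smult p h" by (simp add: algebra_simps)
  then have "pderiv f = pderiv g + smult p (pderiv h)" by (simp add: pderiv_add pderiv_smult)
  then have "pderiv f - pderiv g = [:p:] * pderiv h" by simp
  then show ?thesis unfolding Mp_eq_iff_dvd by (rule dvdI)
qed

text \<open>A polynomial with vanishing derivative is a polynomial in \<open>x\<^sup>p\<close>, hence a \<open>p\<close>-th power.\<close>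

lemma Mp_pderiv_irreducible:
  assumes g: "g \<in> monic_irreducibles"
  shows "Mp (pderiv g) \<noteq> 0"
proof
  assume 0: "Mp (pderiv g) = 0"
  let ?P = "nat p"
  have red: "Mp g = g" and irr: "irreducible_m g" using g by (auto simp: monic_irreducibles_def)
  have bounds: "0 \<le> coeff g i" "coeff g i < p" for i using red unfolding Mp_ident_iff by auto
  \<comment> \<open>Since the derivative vanishes modulo \<open>p\<close>, the prime divides
    \<open>i * coeff g i\<close>, and a reduced coefficient divisible by \<open>p\<close> is
    0.\<close>
  have zero: "coeff g i = 0" if "\<not> ?P dvd i" for i
  proof (cases i)
    case 0
    then show ?thesis using that by simp
  next
    case (Suc k)
    have "M (coeff (pderiv g) k) = 0" using arg_cong[OF 0, of "\<lambda>f. coeff f k"] by (simp add: Mp_coeff)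
    then have "p dvd int i * coeff g i" by (simp add: M_def coeff_pderiv Suc mod_0_imp_dvd)
    moreover have "\<not> p dvd int i" using that nat_p(2) by (metis int_dvd_int_iff)
    ultimately have "p dvd coeff g i" using prime prime_dvd_mult_iff by blast
    then show ?thesis using bounds[of i] zdvd_imp_le[of p "coeff g i"] by force
  qed
  \<comment> \<open>The candidate for a \<open>p\<close>-th root: exponents are divided by
    \<open>p\<close>, and coefficients are kept because they are their own \<open>p\<close>-th
    powers modulo \<open>p\<close>. Indices above \<open>degree g div p\<close> contribute
    0.\<close>
  define h where "h = (\<Sum>i\<le>degree g. monom (coeff g (?P * i)) i)"
  have "Mp (h ^ ?P) = Mp (\<Sum>i\<le>degree g. monom (coeff g (?P * i)) i ^ ?P)"
    unfolding h_def by (rule Mp_sum_power_p) simp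
  also have "\<dots> = Mp (\<Sum>i\<le>degree g. monom (coeff g (?P * i)) (?P * i))"
  proof (rule Mp_sum_cong)
    fix i
    have "Mp (monom (coeff g (?P * i) ^ ?P) (?P * i)) = Mp (monom (coeff g (?P * i)) (?P * i))"
      using power_p_mod[OF bounds(1)] by (simp add: poly_eq_iff Mp_coeff)
    then show "Mp (monom (coeff g (?P * i)) i ^ ?P) = Mp (monom (coeff g (?P * i)) (?P * i))"
      by (simp add: monom_power mult.commute)
  qed
  also have "(\<Sum>i\<le>degree g. monom (coeff g (?P * i)) (?P * i)) = g"
  proof (rule poly_eqI)
    fix k
    have "coeff (\<Sum>i\<le>degree g. monom (coeff g (?P * i)) (?P * i)) k
        = (\<Sum>i\<le>degree g. if ?P * i = k then coeff g k else 0)"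
      by (simp add: coeff_sum) (intro sum.cong, auto)
    also have "\<dots> = coeff g k"
    proof (cases "?P dvd k \<and> k \<le> degree g")
      case True
      then obtain j where j: "k = ?P * j" by auto
      have iff: "?P * i = k \<longleftrightarrow> i = j" for i using j nat_p(3) by auto
      have "1 * j \<le> ?P * j" using nat_p(3) by (intro mult_le_mono) auto
      then have "j \<le> degree g" using True j by linarith
      then show ?thesis unfolding iff by simp
    next
      case False
      then have "coeff g k = 0" using zero by (auto intro: coeff_eq_0)
      then show ?thesis by (simp add: if_distrib cong: if_cong)
    qed
    finally show "coeff (\<Sum>i\<le>degree g. monom (coeff g (?P * i)) (?P * i)) k = coeff g k" .
  qed
  finally have eq: "Mp (h ^ ?P) = Mp g" .
  have split: "h ^ ?P = h * h ^ (?P - 1)" using nat_p(3) by (simp add: power_eq_if)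
  have "h dvdm 1 \<or> h ^ (?P - 1) dvdm 1"
    using irr eq unfolding irreducible_m_def split by metis
  \<comment> \<open>As \<open>p - 1\<close> is at least 1, \<open>h\<close> is a unit in either
    case.\<close>
  moreover have "h dvdm h ^ (?P - 1)" using nat_p(3) by (intro dvd_imp_dvdm dvd_power) auto
  ultimately have "h dvdm 1" using dvdm_trans by blast
  then obtain w where "Mp 1 = Mp (h * w)" by (auto simp: dvdm_def)
  then have "[:p:] dvd h * w - 1" by (metis Mp_eq_iff_dvd)
  \<comment> \<open>This turns the inverse \<open>w\<close> of \<open>h\<close> into the inverse
    \<open>w ^ p\<close> of \<open>h ^ p\<close>, and so of \<open>g\<close>.\<close>
  moreover have "h * w - 1 dvd (h * w) ^ ?P - 1" by (metis power_diff_1_eq dvd_triv_left)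
  ultimately have "Mp ((h * w) ^ ?P) = Mp 1" unfolding Mp_eq_iff_dvd by (rule dvd_trans)
  then have "h ^ ?P dvdm 1" unfolding dvdm_def by (metis power_mult_distrib)
  then have "g dvdm 1" using dvdm_cong[OF eq refl] by blast
  then show False using irr by (simp add: irreducible_m_def)
qed

text \<open>For an irreducible common factor \<open>g\<close> of \<open>f\<close> and its derivative
  write \<open>f = g * h\<close> modulo \<open>p\<close>. By the product rule \<open>g\<close>
  divides \<open>h * pderiv g\<close>. It cannot divide \<open>pderiv g\<close>, which is nonzero
  modulo \<open>p\<close> and of smaller degree, so it divides \<open>h\<close> and is a repeated
  factor. Conversely, a repeated factor divides the derivative.\<close>

lemma dvd_resultant_pderiv_iff:
  assumes mon: "monic f" and deg: "degree f > 0"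
    and Q: "set_mset Q \<subseteq> monic_irreducibles" and fQ: "Mp f = Mp (prod_mset Q)"
  shows "p dvd resultant f (pderiv f) \<longleftrightarrow> (\<exists>g. count Q g > 1)"
proof -
  have derivQ: "Mp (pderiv f) = Mp (pderiv (prod_mset Q))" using fQ by (rule Mp_pderiv_cong)
  have "(\<exists>d. monic d \<and> degree d > 0 \<and> d dvdm f \<and> d dvdm pderiv f) \<longleftrightarrow> (\<exists>g. count Q g > 1)"
  proof
    assume "\<exists>d. monic d \<and> degree d > 0 \<and> d dvdm f \<and> d dvdm pderiv f"
    then obtain d where d: "monic d" "degree d > 0" "d dvdm f" "d dvdm pderiv f" by blast
    obtain R where R: "set_mset R \<subseteq> monic_irreducibles" "Mp (prod_mset R) = Mp d"
      using reduced_monic_factorization[OF Mp_in_reduced_monic[OF d(1)]] by blast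
    have "R \<noteq> {#}"
    proof
      assume "R = {#}"
      then have "degree_m d = 0" using R(2) by (metis Mp_1 degree_1 prod_mset_empty)
      then show False using d(1,2) by simp
    qed
    then obtain g where g: "g \<in># R" by blast
    then have "g dvdm prod_mset R" by (intro dvd_imp_dvdm dvd_prod_mset)
    then have "g dvdm d" using R(2) dvdm_cong by blast
    then have gf: "g dvdm f" and gf': "g dvdm pderiv f" using d dvdm_trans by blast+
    have girr: "g \<in> monic_irreducibles" using g R(1) by blast
    have "g dvdm prod_mset Q" using gf fQ dvdm_cong by blast
    then have "g \<in># Q" by (rule irreducible_dvdm_prod_mset[OF girr Q])
    then obtain Q' where Q': "Q = add_mset g Q'" by (metis multi_member_split)
    let ?h = "prod_mset Q'"
    have "g dvdm g * pderiv ?h + ?h * pderiv g"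
      using gf' derivQ dvdm_cong[OF refl derivQ, of g] by (simp add: Q' pderiv_mult)
    moreover have "g dvdm - (g * pderiv ?h)" by (rule dvd_imp_dvdm) simp
    ultimately have "g dvdm (g * pderiv ?h + ?h * pderiv g) + - (g * pderiv ?h)" by (rule dvdm_add)
    then have "g dvdm ?h * pderiv g" by simp
    then have "g dvdm ?h \<or> g dvdm pderiv g"
      using girr by (intro irreducible_m_dvdm_mult) (auto simp: monic_irreducibles_def)
    moreover have "\<not> g dvdm pderiv g"
    proof
      assume "g dvdm pderiv g"
      then have "degree g \<le> degree (pderiv g)"
        using girr Mp_pderiv_irreducible[OF girr] by (intro dvdm_degree) (auto simp: monic_irreducibles_def)
      then show False using monic_irreducibles_degree_pos[OF girr] by (simp add: degree_pderiv)
    qed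
    ultimately have "g \<in># Q'" using irreducible_dvdm_prod_mset[OF girr, of Q'] Q Q' by auto
    then have "count Q g > 1" by (simp add: Q')
    then show "\<exists>g. count Q g > 1" ..
  next
    assume "\<exists>g. count Q g > 1"
    then obtain g where g: "count Q g > 1" ..
    then have "g \<in># Q" by (auto intro: count_inI)
    then obtain Q' where Q': "Q = add_mset g Q'" by (metis multi_member_split)
    with g have "g \<in># Q'" by (auto intro: count_inI)
    then obtain R where R: "Q = add_mset g (add_mset g R)" using Q' by (metis multi_member_split)
    have girr: "g \<in> monic_irreducibles" using Q R by simp
    have "g dvd prod_mset Q" by (simp add: R)
    then have "g dvdm f" using fQ dvd_imp_dvdm dvdm_cong by blast
    moreover have "g dvd pderiv (prod_mset Q)" by (simp add: R pderiv_mult)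
    then have "g dvdm pderiv f" using derivQ dvd_imp_dvdm dvdm_cong by blast
    ultimately show "\<exists>d. monic d \<and> degree d > 0 \<and> d dvdm f \<and> d dvdm pderiv f"
      using girr monic_irreducibles_degree_pos[OF girr] by (auto simp: monic_irreducibles_def)
  qed
  then show ?thesis unfolding dvd_resultant_iff[OF mon deg] .
qed

section \<open>Discriminant and splitting type read off from the factorization\<close>

lemma not_dvd_poly_disc_iff:
  assumes "monic f" "degree f > 0"
    and "set_mset Q \<subseteq> monic_irreducibles" "Mp f = Mp (prod_mset Q)"
  shows "\<not> p dvd poly_disc f \<longleftrightarrow> (\<forall>g. count Q g \<le> 1)"
proof -
  \<comment> \<open>For monic \<open>f\<close> the discriminant is this resultant up to
    sign.\<close>
  have "p dvd poly_disc f \<longleftrightarrow> p dvd resultant f (pderiv f)"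
    using assms(1) by (simp add: poly_disc_def minus_one_power_iff)
  then show ?thesis using dvd_resultant_pderiv_iff[OF assms] by (simp add: not_less)
qed

lemma splitting_type_eq:
  assumes "set_mset Q \<subseteq> monic_irreducibles" "Mp f = Mp (prod_mset Q)" "\<forall>g. count Q g \<le> 1"
  shows "splitting_type (nat p) f = image_mset degree Q"
proof -
  have "monic_irred_factors_mod (nat p) f = {g \<in> monic_irreducibles. g dvdm f}"
    unfolding monic_irred_factors_mod_def monic_irreducibles_def nat_p(2) by auto
  also have "\<dots> = set_mset Q"
    using dvdm_prod_mset_iff[OF _ assms(1)] dvdm_cong[OF refl assms(2)] assms(1) by blast
  finally have set: "monic_irred_factors_mod (nat p) f = set_mset Q" .
  show ?thesis
    using mset_set_set_mset_distinct[OF assms(3)] by (simp add: splitting_type_def set)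
qed

end

section \<open>Residue classes in boxes\<close>

text \<open>A common form for boxes, for reduced representatives of residues and for a residue class
  inside a box, so that each is counted as a product over the coefficients.\<close>

definition monic_with :: "nat \<Rightarrow> (nat \<Rightarrow> int set) \<Rightarrow> int poly set" where
  "monic_with n A = {f. degree f = n \<and> monic f \<and> (\<forall>j<n. coeff f j \<in> A j)}"

lemma monic_box_eq_monic_with: "monic_box n B = monic_with n (\<lambda>_. {-B<..B})"
  by (auto simp: monic_box_def monic_with_def)

lemma ex_monic_with_coeffs:
  fixes F :: "nat \<Rightarrow> int"
  shows "\<exists>f. degree f = n \<and> monic f \<and> (\<forall>j<n. coeff f j = F j)"
proof -
  define f where "f = monom 1 n + (\<Sum>j<n. monom (F j) j)"
  have c: "coeff f k = (if k = n then 1 else if k < n then F k else 0)" for k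
    by (simp add: f_def coeff_sum)
  have "degree f \<le> n" by (rule degree_le) (simp add: c)
  moreover have "n \<le> degree f" by (rule le_degree) (simp add: c)
  ultimately have "degree f = n" by simp
  then show ?thesis by (intro exI[of _ f]) (simp add: c)
qed

lemma monic_eqI:
  assumes "degree f = n" "monic f" "degree g = n" "monic g" "\<And>j. j < n \<Longrightarrow> coeff f j = coeff g j"
  shows "f = g"
proof (rule poly_eqI)
  fix j
  show "coeff f j = coeff g j"
    using assms by (cases j n rule: linorder_cases) (auto simp: coeff_eq_0)
qed

lemma bij_betw_monic_with:
  "bij_betw (\<lambda>f. restrict (coeff f) {..<n}) (monic_with n A) (PiE {..<n} A)"
  unfolding bij_betw_def
proof
  show "inj_on (\<lambda>f. restrict (coeff f) {..<n}) (monic_with n A)"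
  proof (rule inj_onI)
    fix f g assume fg: "f \<in> monic_with n A" "g \<in> monic_with n A"
      and eq: "restrict (coeff f) {..<n} = restrict (coeff g) {..<n}"
    show "f = g"
    proof (rule monic_eqI[of _ n])
      fix j assume "j < n"
      then show "coeff f j = coeff g j" using fun_cong[OF eq, of j] by simp
    qed (use fg in \<open>auto simp: monic_with_def\<close>)
  qed
  show "(\<lambda>f. restrict (coeff f) {..<n}) ` monic_with n A = PiE {..<n} A"
  proof (intro equalityI subsetI)
    fix F assume "F \<in> (\<lambda>f. restrict (coeff f) {..<n}) ` monic_with n A"
    then obtain f where "f \<in> monic_with n A" "F = restrict (coeff f) {..<n}" by blast
    then show "F \<in> PiE {..<n} A" by (simp add: monic_with_def restrict_PiE_iff)
  next
    fix F assume F: "F \<in> PiE {..<n} A"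
    obtain f where f: "degree f = n" "monic f" "\<forall>j<n. coeff f j = F j"
      using ex_monic_with_coeffs by blast
    then have "f \<in> monic_with n A" using F by (auto simp: monic_with_def)
    moreover have "restrict (coeff f) {..<n} = F"
      using f(3) F by (auto simp: restrict_def PiE_def extensional_def fun_eq_iff)
    ultimately show "F \<in> (\<lambda>f. restrict (coeff f) {..<n}) ` monic_with n A" by blast
  qed
qed

lemma card_monic_with: "card (monic_with n A) = (\<Prod>j<n. card (A j))"
  using bij_betw_same_card[OF bij_betw_monic_with, of n A] by (simp add: card_PiE)

lemma finite_monic_with:
  assumes "\<And>j. j < n \<Longrightarrow> finite (A j)"
  shows "finite (monic_with n A)"
proof -
  have "finite (PiE {..<n} A)" using assms by (intro finite_PiE) auto
  then show ?thesis using bij_betw_finite[OF bij_betw_monic_with] by blast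
qed

text \<open>The members are \<open>c + M * k\<close> with \<open>k\<close> between two floors whose
  unrounded difference is \<open>2 * B / M\<close>. Each floor loses between 0 and 1, so their
  difference is off by at most 1.\<close>

lemma card_residue_class_interval:
  fixes M B c :: int
  assumes "M > 0" "0 \<le> c" "c < M" "B \<ge> 0"
  shows "2 * real_of_int B / M - 1 \<le> card {x \<in> {-B<..B}. x mod M = c}"
    and "card {x \<in> {-B<..B}. x mod M = c} \<le> 2 * real_of_int B / M + 1"
proof -
  let ?l = "(- B - c) div M" and ?u = "(B - c) div M"
  have le_div: "k \<le> a div M \<longleftrightarrow> M * k \<le> a" for k a
  proof
    assume "k \<le> a div M"
    then have "M * k \<le> M * (a div M)" using \<open>M > 0\<close> by simp
    also have "\<dots> \<le> a" using pos_mod_sign[OF \<open>M > 0\<close>, of a] mult_div_mod_eq[of M a] by linarith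
    finally show "M * k \<le> a" .
  next
    assume "M * k \<le> a"
    then have "M * k div M \<le> a div M" using \<open>M > 0\<close> by (rule zdiv_mono1)
    then show "k \<le> a div M" using \<open>M > 0\<close> by simp
  qed
  have "{x \<in> {-B<..B}. x mod M = c} = (\<lambda>k. c + M * k) ` {?l<..?u}"
  proof (intro equalityI subsetI)
    fix x assume x: "x \<in> {x \<in> {-B<..B}. x mod M = c}"
    define k where "k = x div M"
    have xk: "x = c + M * k" using x by (auto simp: k_def)
    \<comment> \<open>The strict bound \<open>- B < x\<close> is the negation of
      \<open>x \<le> - B\<close>, so a floor serves at the left end too, and the interval for
      \<open>k\<close> is again open on the left.\<close>
    have "\<not> k \<le> ?l" "k \<le> ?u" using x unfolding le_div xk by auto
    then show "x \<in> (\<lambda>k. c + M * k) ` {?l<..?u}" using xk by auto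
  next
    fix x assume "x \<in> (\<lambda>k. c + M * k) ` {?l<..?u}"
    then obtain k where k: "x = c + M * k" "k \<in> {?l<..?u}" by blast
    then have "\<not> M * k \<le> - B - c" "M * k \<le> B - c" by (auto simp flip: le_div)
    then show "x \<in> {x \<in> {-B<..B}. x mod M = c}" using assms k(1) by simp
  qed
  moreover have "inj_on (\<lambda>k. c + M * k) {?l<..?u}" using \<open>M > 0\<close> by (auto simp: inj_on_def)
  ultimately have card: "card {x \<in> {-B<..B}. x mod M = c} = nat (?u - ?l)"
    by (simp add: card_image)
  have "?l \<le> ?u" using assms by (intro zdiv_mono1) auto
  then have real: "real (card {x \<in> {-B<..B}. x mod M = c}) = real_of_int ?u - real_of_int ?l"
    unfolding card by simp
  have bounds: "real_of_int a / M - 1 \<le> real_of_int (a div M)"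
    "real_of_int (a div M) \<le> real_of_int a / M" for a
    using real_of_int_div4[of a M] real_of_int_div3[of a M] by linarith+
  have diff: "real_of_int (B - c) / M - real_of_int (- B - c) / M = 2 * real_of_int B / M"
    by (simp add: diff_divide_distrib)
  show "2 * real_of_int B / M - 1 \<le> card {x \<in> {-B<..B}. x mod M = c}"
    using bounds(1)[of "B - c"] bounds(2)[of "- B - c"] diff unfolding real by linarith
  show "card {x \<in> {-B<..B}. x mod M = c} \<le> 2 * real_of_int B / M + 1"
    using bounds(2)[of "B - c"] bounds(1)[of "- B - c"] diff unfolding real by linarith
qed

lemma Mp_in_monic_with:
  assumes "degree f = n" "monic f" "q > 1"
  shows "poly_mod.Mp q f \<in> monic_with n (\<lambda>_. {0..<q})"
proof -
  interpret poly_mod_2 q using assms(3) by unfold_locales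
  show ?thesis using assms by (auto simp: monic_with_def Mp_coeff M_def)
qed

section \<open>The Chinese remainder theorem and residue counts in boxes\<close>

context
  fixes I :: "'i set" and q :: "'i \<Rightarrow> nat" and M :: nat
  assumes fin: "finite I" and primes: "\<And>i. i \<in> I \<Longrightarrow> prime (q i)" and inj: "inj_on q I"
    and M: "M = (\<Prod>i\<in>I. q i)"
begin

lemma modulus_pos: "M > 0"
  unfolding M using primes by (intro prod_pos) (auto dest: prime_gt_0_nat)

lemma prime_dvd_modulus: "i \<in> I \<Longrightarrow> int (q i) dvd int M"
  unfolding M int_dvd_int_iff using fin by (rule dvd_prodI)

lemma modulus_dvd_if_primes_dvd:
  fixes x :: int
  assumes "\<And>i. i \<in> I \<Longrightarrow> int (q i) dvd x"
  shows "int M dvd x"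
  unfolding M of_nat_prod using fin assms primes inj
proof (induction I rule: finite_induct)
  case (insert i I)
  have "algebraic_semidom_class.coprime (int (q i)) (\<Prod>j\<in>I. int (q j))"
  proof (rule prod_coprime_right)
    fix j assume "j \<in> I"
    then have "q i \<noteq> q j" using insert by auto
    then have "algebraic_semidom_class.coprime (q i) (q j)"
      using insert \<open>j \<in> I\<close> by (intro primes_coprime) auto
    then show "algebraic_semidom_class.coprime (int (q i)) (int (q j))" by simp
  qed
  moreover have "int (q i) dvd x" "(\<Prod>j\<in>I. int (q j)) dvd x" using insert by auto
  ultimately show ?case using insert by (simp add: divides_mult)
qed simp

text \<open>Injectivity is clear and both sides have \<open>M\<^sup>n\<close> elements, so existence in the Chinese
  remainder theorem comes for free.\<close>

lemma bij_betw_chinese_remainder: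
  "bij_betw (\<lambda>f. \<lambda>i\<in>I. poly_mod.Mp (int (q i)) f) (monic_with n (\<lambda>_. {0..<int M}))
     (PiE I (\<lambda>i. monic_with n (\<lambda>_. {0..<int (q i)})))"
  (is "bij_betw ?h ?P ?R")
proof -
  have sub: "?h ` ?P \<subseteq> ?R"
  proof (rule image_subsetI, rule restrict_PiE_iff[THEN iffD2], rule ballI)
    fix f i assume "f \<in> ?P" "i \<in> I"
    then show "poly_mod.Mp (int (q i)) f \<in> monic_with n (\<lambda>_. {0..<int (q i)})"
      using primes[of i] prime_gt_1_nat by (intro Mp_in_monic_with) (auto simp: monic_with_def)
  qed
  have inj: "inj_on ?h ?P"
  proof (rule inj_onI)
    fix f g assume f: "f \<in> ?P" and g: "g \<in> ?P" and eq: "?h f = ?h g"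
    show "f = g"
    proof (rule monic_eqI[of _ n])
      fix j assume j: "j < n"
      have "int (q i) dvd coeff f j - coeff g j" if "i \<in> I" for i
      proof -
        have "poly_mod.Mp (int (q i)) f = poly_mod.Mp (int (q i)) g"
          using fun_cong[OF eq, of i] that by simp
        then have "coeff f j mod int (q i) = coeff g j mod int (q i)"
          by (metis poly_mod.Mp_coeff poly_mod.M_def)
        then show ?thesis by (simp add: mod_eq_dvd_iff)
      qed
      then have "coeff f j mod int M = coeff g j mod int M"
        using modulus_dvd_if_primes_dvd by (simp add: mod_eq_dvd_iff)
      then show "coeff f j = coeff g j" using f g j by (auto simp: monic_with_def)
    qed (use f g in \<open>auto simp: monic_with_def\<close>)
  qed
  have "card ?P = M ^ n" by (simp add: card_monic_with)
  also have "\<dots> = card ?R" using fin by (simp add: card_PiE card_monic_with M prod_power_distrib)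
  finally have "card ?P = card ?R" .
  moreover have "finite ?R" using fin by (intro finite_PiE finite_monic_with) auto
  ultimately have "?h ` ?P = ?R" using sub inj by (intro card_subset_eq) (simp_all add: card_image)
  with inj show ?thesis by (simp add: bij_betw_def)
qed

text \<open>The box is split by the residue \<open>g\<close> modulo \<open>M\<close>. The Chinese
  remainder theorem counts the admissible residues, and each fibre is a product of \<open>n\<close>
  residue classes in an interval. The hypothesis on \<open>B\<close> makes
  \<open>2 * B / M - 1\<close> nonnegative, so that the lower bounds may be multiplied.\<close>

lemma monic_box_residue_count:
  fixes B :: int and A :: "'i \<Rightarrow> int poly set"
  assumes A: "\<And>i. i \<in> I \<Longrightarrow> A i \<subseteq> monic_with n (\<lambda>_. {0..<int (q i)})"
    and B: "2 * real_of_int B / real M \<ge> 1"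
  defines "N \<equiv> card {f \<in> monic_box n B. \<forall>i\<in>I. poly_mod.Mp (int (q i)) f \<in> A i}"
  shows "real (\<Prod>i\<in>I. card (A i)) * (2 * real_of_int B / real M - 1) ^ n \<le> real N"
    and "real N \<le> real (\<Prod>i\<in>I. card (A i)) * (2 * real_of_int B / real M + 1) ^ n"
proof -
  define P where "P = monic_with n (\<lambda>_. {0..<int M})"
  define h where "h = (\<lambda>f. \<lambda>i\<in>I. poly_mod.Mp (int (q i)) f)"
  define C where "C = {g \<in> P. \<forall>i\<in>I. poly_mod.Mp (int (q i)) g \<in> A i}"
  define fib where "fib g = monic_with n (\<lambda>j. {x \<in> {-B<..B}. x mod int M = coeff g j})" for g
  have bij: "bij_betw h P (PiE I (\<lambda>i. monic_with n (\<lambda>_. {0..<int (q i)})))"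
    unfolding h_def P_def by (rule bij_betw_chinese_remainder)
  have "h ` C = PiE I A"
  proof (intro equalityI subsetI)
    fix F assume "F \<in> h ` C"
    then obtain g where "g \<in> C" "F = h g" by blast
    then show "F \<in> PiE I A" by (simp add: h_def C_def restrict_PiE_iff)
  next
    fix F assume F: "F \<in> PiE I A"
    then have "F \<in> PiE I (\<lambda>i. monic_with n (\<lambda>_. {0..<int (q i)}))" using A by (auto simp: PiE_iff)
    then have "F \<in> h ` P" using bij by (simp add: bij_betw_def)
    then obtain g where g: "g \<in> P" "F = h g" by blast
    then have "poly_mod.Mp (int (q i)) g \<in> A i" if "i \<in> I" for i
      using F that by (auto simp: h_def PiE_iff)
    then show "F \<in> h ` C" using g by (auto simp: C_def)
  qed
  moreover have "inj_on h C" using bij by (auto simp: bij_betw_def C_def intro: inj_on_subset)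
  ultimately have "card C = card (PiE I A)" using card_image by metis
  then have cardC: "card C = (\<Prod>i\<in>I. card (A i))" using fin by (simp add: card_PiE)
  have Mpos: "int M > 0" using modulus_pos by simp
  have "finite P" unfolding P_def by (rule finite_monic_with) simp
  then have finC: "finite C" by (simp add: C_def)
  have Mp_fib: "poly_mod.Mp (int (q i)) f = poly_mod.Mp (int (q i)) g"
    if "g \<in> P" "f \<in> fib g" "i \<in> I" for f g i
  proof (rule poly_eqI, unfold poly_mod.Mp_coeff poly_mod.M_def)
    fix j
    show "coeff f j mod int (q i) = coeff g j mod int (q i)"
    proof (cases "j < n")
      case True
      then have "coeff f j mod int M = coeff g j" using that by (simp add: fib_def monic_with_def)
      then show ?thesis using prime_dvd_modulus[OF that(3)] by (metis mod_mod_cancel)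
    next
      case False
      then have "coeff f j = coeff g j" using that
        by (cases "j = n") (auto simp: fib_def P_def monic_with_def coeff_eq_0)
      then show ?thesis by simp
    qed
  qed
  have "{f \<in> monic_box n B. \<forall>i\<in>I. poly_mod.Mp (int (q i)) f \<in> A i} = (\<Union>g\<in>C. fib g)"
  proof (intro equalityI subsetI)
    fix f assume f: "f \<in> {f \<in> monic_box n B. \<forall>i\<in>I. poly_mod.Mp (int (q i)) f \<in> A i}"
    obtain g where g: "degree g = n" "monic g" "\<forall>j<n. coeff g j = coeff f j mod int M"
      using ex_monic_with_coeffs[of n "\<lambda>j. coeff f j mod int M"] by blast
    have gP: "g \<in> P" using g Mpos by (auto simp: P_def monic_with_def)
    have fg: "f \<in> fib g" using f g by (auto simp: fib_def monic_with_def monic_box_eq_monic_with)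
    then have "g \<in> C" using f gP Mp_fib[OF gP fg] by (auto simp: C_def)
    with fg show "f \<in> (\<Union>g\<in>C. fib g)" by blast
  next
    fix f assume "f \<in> (\<Union>g\<in>C. fib g)"
    then obtain g where g: "g \<in> C" "f \<in> fib g" by blast
    then have "poly_mod.Mp (int (q i)) f \<in> A i" if "i \<in> I" for i
      using Mp_fib[of g f i] that by (auto simp: C_def)
    then show "f \<in> {f \<in> monic_box n B. \<forall>i\<in>I. poly_mod.Mp (int (q i)) f \<in> A i}"
      using g by (auto simp: fib_def monic_with_def monic_box_eq_monic_with)
  qed
  moreover have "fib g \<inter> fib g' = {}" if "g \<in> C" "g' \<in> C" "g \<noteq> g'" for g g'
  proof (rule ccontr)
    assume "fib g \<inter> fib g' \<noteq> {}"
    then obtain f where f: "f \<in> fib g" "f \<in> fib g'" by blast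
    have "g = g'"
      by (rule monic_eqI[of _ n]) (use that f in \<open>auto simp: C_def P_def fib_def monic_with_def\<close>)
    with that show False by simp
  qed
  moreover have "finite (fib g)" for g unfolding fib_def
    by (rule finite_monic_with, rule finite_subset[of _ "{-B<..B}"]) auto
  ultimately have N: "N = (\<Sum>g\<in>C. card (fib g))"
    unfolding N_def using finC by (simp add: card_UN_disjoint)
  have "B \<ge> 0"
  proof (rule ccontr)
    assume "\<not> B \<ge> 0"
    then have "2 * real_of_int B / real M < 0" using Mpos by (simp add: divide_neg_pos)
    with B show False by simp
  qed
  have fib: "real (card (fib g)) = (\<Prod>j<n. real (card {x \<in> {-B<..B}. x mod int M = coeff g j}))"
    for g unfolding fib_def card_monic_with by simp
  have res: "2 * real_of_int B / real M - 1 \<le> card {x \<in> {-B<..B}. x mod int M = coeff g j}"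
    "card {x \<in> {-B<..B}. x mod int M = coeff g j} \<le> 2 * real_of_int B / real M + 1"
    if "g \<in> C" "j < n" for g j
    using card_residue_class_interval[OF Mpos _ _ \<open>B \<ge> 0\<close>, of "coeff g j"] that
    by (auto simp: C_def P_def monic_with_def)
  have lo: "(2 * real_of_int B / real M - 1) ^ n \<le> real (card (fib g))" if "g \<in> C" for g
  proof -
    have "(2 * real_of_int B / real M - 1) ^ n = (\<Prod>j<n. 2 * real_of_int B / real M - 1)" by simp
    also have "\<dots> \<le> real (card (fib g))" unfolding fib
      using res(1)[OF that] B by (intro prod_mono) auto
    finally show ?thesis .
  qed
  have hi: "real (card (fib g)) \<le> (2 * real_of_int B / real M + 1) ^ n" if "g \<in> C" for g
  proof -
    have "real (card (fib g)) \<le> (\<Prod>j<n. 2 * real_of_int B / real M + 1)" unfolding fib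
      using res(2)[OF that] by (intro prod_mono) auto
    then show ?thesis by simp
  qed
  have "real (card C) * (2 * real_of_int B / real M - 1) ^ n
      = (\<Sum>g\<in>C. (2 * real_of_int B / real M - 1) ^ n)" by simp
  also have "\<dots> \<le> (\<Sum>g\<in>C. real (card (fib g)))" by (rule sum_mono) (rule lo)
  finally show "real (\<Prod>i\<in>I. card (A i)) * (2 * real_of_int B / real M - 1) ^ n \<le> real N"
    by (simp only: N cardC of_nat_sum)
  have "(\<Sum>g\<in>C. real (card (fib g))) \<le> (\<Sum>g\<in>C. (2 * real_of_int B / real M + 1) ^ n)"
    by (rule sum_mono) (rule hi)
  also have "\<dots> = real (card C) * (2 * real_of_int B / real M + 1) ^ n" by simp
  finally show "real N \<le> real (\<Prod>i\<in>I. card (A i)) * (2 * real_of_int B / real M + 1) ^ n"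
    by (simp only: N cardC of_nat_sum)
qed

end

section \<open>Counting polynomials modulo a prime\<close>

context poly_mod_prime
begin

lemma reduced_monic_eq_monic_with: "reduced_monic n = monic_with n (\<lambda>_. {0..<p})"
proof (intro equalityI subsetI)
  fix f assume "f \<in> reduced_monic n"
  then show "f \<in> monic_with n (\<lambda>_. {0..<p})"
    unfolding reduced_monic_def Mp_ident_iff by (auto simp: monic_with_def)
next
  fix f assume f: "f \<in> monic_with n (\<lambda>_. {0..<p})"
  have "coeff f j \<in> {0..<p}" for j
    using f m1 by (cases j n rule: linorder_cases) (auto simp: monic_with_def coeff_eq_0)
  with f show "f \<in> reduced_monic n"
    unfolding reduced_monic_def Mp_ident_iff by (auto simp: monic_with_def)
qed

lemma card_reduced_monic: "card (reduced_monic n) = nat p ^ n"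
  by (simp add: reduced_monic_eq_monic_with card_monic_with)

text \<open>Unique factorization turns the \<open>p ^ n\<close> choices of reduced coefficients into
  the counting axiom of the locale.\<close>

sublocale factorizations: weighted_multisets monic_irreducibles degree "nat p"
proof
  show "card {Q. set_mset Q \<subseteq> monic_irreducibles \<and> (\<Sum>g\<in>#Q. degree g) = n} = nat p ^ n" for n
    using bij_betw_same_card[OF bij_betw_prod_mset_reduced_monic] card_reduced_monic by metis
  show "nat p > 0" using nat_p(3) by simp
qed (rule monic_irreducibles_degree_pos)

lemma necklace_eq_card_level:
  assumes "n > 0"
  shows "necklace n (real (nat p)) = real (card (factorizations.level n))"
  using factorizations.sum_divisors_card_level
  by (intro necklace_eq_if_sum_divisors[where N = "\<lambda>n. card (factorizations.level n)", OF assms])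

lemma obtain_factorization:
  assumes "monic f"
  obtains Q where "set_mset Q \<subseteq> monic_irreducibles" "Mp f = Mp (prod_mset Q)"
  using reduced_monic_factorization[OF Mp_in_reduced_monic[OF assms]] by metis

text \<open>Both polynomials share the factorization \<open>Q\<close> modulo \<open>p\<close>, on
  which alone the discriminant criterion depends. This lets the condition on a polynomial in the box
  be tested on its residue.\<close>

lemma not_dvd_poly_disc_Mp:
  assumes "monic f" "degree f > 0"
  shows "\<not> p dvd poly_disc (Mp f) \<longleftrightarrow> \<not> p dvd poly_disc f"
proof -
  obtain Q where Q: "set_mset Q \<subseteq> monic_irreducibles" "Mp f = Mp (prod_mset Q)"
    using obtain_factorization[OF assms(1)] .
  have "monic (Mp f)" using assms(1) by (rule monic_Mp)
  moreover have "degree (Mp f) > 0" using assms by simp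
  moreover have "Mp (Mp f) = Mp (prod_mset Q)" using Q(2) by simp
  ultimately show ?thesis
    using not_dvd_poly_disc_iff[OF _ _ Q(1)] assms Q(2) by metis
qed

lemma splitting_type_Mp: "splitting_type (nat p) (Mp f) = splitting_type (nat p) f"
  unfolding splitting_type_def monic_irred_factors_mod_def nat_p(2) by simp

text \<open>The predicate \<open>P\<close> serves two counts: constantly true for all squarefree
  polynomials, and equality with \<open>t\<close> for those of one splitting type.\<close>

lemma bij_betw_reduced_monic_squarefree:
  assumes "n > 0"
  shows "bij_betw (\<lambda>Q. Mp (prod_mset Q)) {Q \<in> factorizations.distinct_of_weight n. P (image_mset degree Q)}
    {f \<in> reduced_monic n. \<not> p dvd poly_disc f \<and> P (splitting_type (nat p) f)}"
proof -
  have crit: "(\<forall>g. count Q g \<le> 1) \<and> P (image_mset degree Q) \<longleftrightarrow>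
      \<not> p dvd poly_disc (Mp (prod_mset Q)) \<and> P (splitting_type (nat p) (Mp (prod_mset Q)))"
    if Q: "set_mset Q \<subseteq> monic_irreducibles" "(\<Sum>g\<in>#Q. degree g) = n" for Q
  proof -
    have "monic (Mp (prod_mset Q))" "degree (Mp (prod_mset Q)) > 0"
      using monic_prod_mset_irreducibles[OF Q(1)] monic_Mp[of "prod_mset Q"] Q(2) assms by simp_all
    then have "\<not> p dvd poly_disc (Mp (prod_mset Q)) \<longleftrightarrow> (\<forall>g. count Q g \<le> 1)"
      using not_dvd_poly_disc_iff[OF _ _ Q(1)] by simp
    moreover have "splitting_type (nat p) (Mp (prod_mset Q)) = image_mset degree Q"
      if "\<forall>g. count Q g \<le> 1"
      using splitting_type_eq[OF Q(1) _ that] by simp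
    ultimately show ?thesis by metis
  qed
  have "bij_betw (\<lambda>Q. Mp (prod_mset Q))
      {Q \<in> {Q. set_mset Q \<subseteq> monic_irreducibles \<and> (\<Sum>g\<in>#Q. degree g) = n}.
         (\<forall>g. count Q g \<le> 1) \<and> P (image_mset degree Q)}
      {f \<in> reduced_monic n. \<not> p dvd poly_disc f \<and> P (splitting_type (nat p) f)}"
    by (rule bij_betw_Collect[OF bij_betw_prod_mset_reduced_monic]) (use crit in blast)
  then show ?thesis
    by (simp add: factorizations.distinct_of_weight_def factorizations.of_weight_def conj_assoc)
qed

lemma card_reduced_monic_squarefree:
  assumes "n \<ge> 2"
  shows "card {f \<in> reduced_monic n. \<not> p dvd poly_disc f} = nat p ^ (n - 1) * (nat p - 1)"
  using bij_betw_same_card[OF bij_betw_reduced_monic_squarefree[of n "\<lambda>_. True"]] assms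
    factorizations.card_distinct_of_weight[OF assms] by simp

lemma card_reduced_monic_splitting_type:
  assumes "is_partition_of t n" "n > 0"
  shows "card {f \<in> reduced_monic n. \<not> p dvd poly_disc f \<and> splitting_type (nat p) f = t}
    = (\<Prod>i=1..n. card (factorizations.level i) choose count t i)"
proof -
  have t: "0 \<notin># t" "sum_mset t = n" using assms(1) by (auto simp: is_partition_of_def)
  have le: "i \<le> n" if "i \<in># t" for i
    using multi_member_split[OF that] t(2) by auto
  \<comment> \<open>A multiset of type \<open>t\<close> automatically has weight
    \<open>sum_mset t = n\<close>.\<close>
  have "{Q \<in> factorizations.distinct_of_weight n. image_mset degree Q = t}
      = {Q. set_mset Q \<subseteq> monic_irreducibles \<and> (\<forall>x. count Q x \<le> 1) \<and> image_mset degree Q = t}"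
    using t(2) by (auto simp: factorizations.distinct_of_weight_def factorizations.of_weight_def)
  then show ?thesis
    using bij_betw_same_card[OF bij_betw_reduced_monic_squarefree[OF assms(2), of "\<lambda>s. s = t"]]
      factorizations.card_distinct_of_type[OF t(1) le] by simp
qed

text \<open>The normalization \<open>p ^ (n - 1) * (p - 1)\<close> in \<open>nu_star\<close> is the
  number of squarefree polynomials. The generalized binomials become ordinary ones because the
  necklace values are numbers of irreducibles.\<close>

lemma nu_star_eq_card_ratio:
  assumes "is_partition_of t n" "n \<ge> 2"
  shows "nu_star n (nat p) t
    = real (card {f \<in> reduced_monic n. \<not> p dvd poly_disc f \<and> splitting_type (nat p) f = t})
      / real (card {f \<in> reduced_monic n. \<not> p dvd poly_disc f})"
proof -
  have "(\<Prod>i=1..n. necklace i (real (nat p)) gchoose count t i)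
      = (\<Prod>i=1..n. real (card (factorizations.level i) choose count t i))"
    by (intro prod.cong refl) (simp add: necklace_eq_card_level binomial_gbinomial)
  moreover have "real (nat p - 1) = real (nat p) - 1" using nat_p(3) by (simp add: of_nat_diff)
  ultimately show ?thesis
    using assms by (simp add: nu_star_def card_reduced_monic_splitting_type
        card_reduced_monic_squarefree del: of_nat_nat)
qed

end

section \<open>The main estimate\<close>

text \<open>Bernoulli's inequality is applied to the powers of
  \<open>(x - 1) / (x + 1) = 1 - 2 / (x + 1)\<close> and of
  \<open>(x - 1) / x = 1 - 1 / x\<close>.\<close>

lemma ratio_power_bounds:
  fixes x :: real and n :: nat
  assumes n: "n > 0" and x: "x \<ge> 8 * real n"
  shows "(x + 1) ^ n \<le> (1 + 8 * real n / x) * (x - 1) ^ n"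
    and "(1 - 8 * real n / x) * (x + 1) ^ n \<le> (x - 1) ^ n"
    and "x ^ n \<le> 2 * (x - 1) ^ n"
proof -
  have n1: "real n \<ge> 1" using n by simp
  then have x8: "x \<ge> 8" using x by linarith
  define t where "t = 2 * real n / (x + 1)"
  have t0: "0 \<le> t" using x8 by (simp add: t_def)
  have t1: "t \<le> 1 / 4" using x x8 by (simp add: t_def field_simps)
  have t2: "2 * t \<le> 8 * real n / x" using x x8 n1 by (simp add: t_def field_simps)
  have bern: "(1 - t) * (x + 1) ^ n \<le> (x - 1) ^ n"
  proof -
    have "1 + real n * (- 2 / (x + 1)) \<le> (1 + - 2 / (x + 1)) ^ n"
      using x8 by (intro Bernoulli_inequality) (simp add: field_simps)
    moreover have "1 + - 2 / (x + 1) = (x - 1) / (x + 1)" using x8 by (simp add: field_simps)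
    ultimately have "1 - t \<le> ((x - 1) / (x + 1)) ^ n" by (simp add: t_def mult.commute)
    then show ?thesis using x8 by (simp add: power_divide pos_le_divide_eq)
  qed
  have "(1 - 8 * real n / x) * (x + 1) ^ n \<le> (1 - t) * (x + 1) ^ n"
    using t0 t2 x8 by (intro mult_right_mono) auto
  with bern show "(1 - 8 * real n / x) * (x + 1) ^ n \<le> (x - 1) ^ n" by linarith
  \<comment> \<open>For \<open>0 \<le> t \<le> 1 / 2\<close> the factor \<open>1 + 2 * t\<close> is
    at least \<open>1 / (1 - t)\<close>, which turns Bernoulli's lower bound into an upper bound for
    the inverse ratio.\<close>
  have "t * (1 - 2 * t) \<ge> 0" using t0 t1 by (intro mult_nonneg_nonneg) auto
  then have "1 \<le> (1 + 2 * t) * (1 - t)" by (simp add: algebra_simps)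
  then have "1 * (x + 1) ^ n \<le> ((1 + 2 * t) * (1 - t)) * (x + 1) ^ n"
    using x8 by (intro mult_right_mono) auto
  also have "\<dots> = (1 + 2 * t) * ((1 - t) * (x + 1) ^ n)" by simp
  also have "\<dots> \<le> (1 + 2 * t) * (x - 1) ^ n" using bern t0 by (intro mult_left_mono) auto
  also have "\<dots> \<le> (1 + 8 * real n / x) * (x - 1) ^ n" using t2 x8 by (intro mult_right_mono) auto
  finally show "(x + 1) ^ n \<le> (1 + 8 * real n / x) * (x - 1) ^ n" by simp
  \<comment> \<open>Since \<open>n / x\<close> is at most \<open>1 / 2\<close>, the power of
    \<open>(x - 1) / x\<close> is at least \<open>1 / 2\<close>; this is the source of the factor
    2.\<close>
  have "1 + real n * (- 1 / x) \<le> (1 + - 1 / x) ^ n"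
    using x8 by (intro Bernoulli_inequality) (simp add: field_simps)
  moreover have "1 + - 1 / x = (x - 1) / x" using x8 by (simp add: field_simps)
  moreover have "real n * (1 / x) \<le> 1 / 2" using x x8 by (simp add: field_simps)
  ultimately have "1 / 2 \<le> ((x - 1) / x) ^ n" by simp
  then show "x ^ n \<le> 2 * (x - 1) ^ n" using x8 by (simp add: power_divide field_simps)
qed

text \<open>Here \<open>a / d\<close> is the density of residues, \<open>NA / ND\<close> its
  approximation in the box and \<open>E\<close> the number of exceptional polynomials. Because
  \<open>a \<le> d\<close>, the relative error \<open>8 * n / x\<close> of \<open>NA / ND\<close> is
  also a bound for the absolute error.\<close>

lemma ratio_deviation_bound:
  fixes a d x NA ND E L :: real and n :: nat
  assumes n: "n > 0" and x: "x \<ge> 8 * real n"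
    and a: "0 \<le> a" "a \<le> d" and d: "d > 0"
    and NA: "a * (x - 1) ^ n \<le> NA" "NA \<le> a * (x + 1) ^ n"
    and ND: "d * (x - 1) ^ n \<le> ND" "ND \<le> d * (x + 1) ^ n"
    and E: "0 \<le> E" "E \<le> L * x ^ n"
  shows "\<bar>(NA - E) / ND - a / d\<bar> \<le> 2 * (L / d) + 8 * real n / x"
proof -
  note rb = ratio_power_bounds[OF n x]
  have x8: "x \<ge> 8" using x n by (simp add: order_trans[of 8 "8 * real n" x])
  let ?e = "8 * real n / x"
  have e: "0 \<le> ?e" "?e \<le> 1" using x x8 by (auto simp: field_simps)
  have lo: "(x - 1) ^ n > 0" using x8 by simp
  have "0 < d * (x - 1) ^ n" using d lo by simp
  then have NDpos: "ND > 0" using ND(1) by linarith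
  have ad: "a / d \<le> 1" "0 \<le> a / d" using a d by simp_all
  have "NA / ND \<le> (a * (x + 1) ^ n) / (d * (x - 1) ^ n)"
    using NA ND a d lo x8 by (intro frac_le) auto
  also have "\<dots> \<le> (a * ((1 + ?e) * (x - 1) ^ n)) / (d * (x - 1) ^ n)"
    using rb(1) a d lo by (intro divide_right_mono mult_left_mono) auto
  also have "\<dots> = a / d * (1 + ?e)" using x8 by auto
  also have "\<dots> \<le> a / d + ?e" using mult_right_mono[OF ad(1) e(1)] by (simp add: algebra_simps)
  finally have up: "NA / ND \<le> a / d + ?e" .
  have hi: "(x + 1) ^ n > 0" using x8 by simp
  have "a / d - ?e \<le> a / d * (1 - ?e)" using mult_right_mono[OF ad(1) e(1)] by (simp add: algebra_simps)
  also have "\<dots> = (a * ((1 - ?e) * (x + 1) ^ n)) / (d * (x + 1) ^ n)" using x8 by auto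
  also have "\<dots> \<le> (a * (x - 1) ^ n) / (d * (x + 1) ^ n)"
    using rb(2) a d hi by (intro divide_right_mono mult_left_mono) auto
  also have "\<dots> \<le> NA / ND"
    using NA ND a lo NDpos by (intro frac_le order_trans[OF mult_nonneg_nonneg NA(1)]) auto
  finally have down: "a / d - ?e \<le> NA / ND" .
  have "x ^ n > 0" using x8 by simp
  moreover have "0 \<le> L * x ^ n" using E by linarith
  ultimately have L: "L \<ge> 0" using mult_neg_pos[of L "x ^ n"] by linarith
  have "E / ND \<le> (L * x ^ n) / (d * (x - 1) ^ n)"
    using E ND d lo by (intro frac_le) auto
  also have "\<dots> \<le> (L * (2 * (x - 1) ^ n)) / (d * (x - 1) ^ n)"
    using rb(3) L d lo by (intro divide_right_mono mult_left_mono) auto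
  also have "\<dots> = 2 * (L / d)" using x8 by auto
  finally have "E / ND \<le> 2 * (L / d)" .
  moreover have "E / ND \<ge> 0" using E NDpos by simp
  ultimately show ?thesis using up down by (simp add: diff_divide_distrib abs_le_iff)
qed

lemma gcd_prod_primes_eq_1_iff:
  fixes a :: int and q :: "'i \<Rightarrow> nat"
  assumes "\<And>i. i \<in> I \<Longrightarrow> prime (q i)" "finite I"
  shows "gcd a (int (\<Prod>i\<in>I. q i)) = 1 \<longleftrightarrow> (\<forall>i\<in>I. \<not> int (q i) dvd a)"
proof
  assume gcd: "gcd a (int (\<Prod>i\<in>I. q i)) = 1"
  show "\<forall>i\<in>I. \<not> int (q i) dvd a"
  proof (intro ballI notI)
    fix i assume i: "i \<in> I" "int (q i) dvd a"
    have "int (q i) dvd int (\<Prod>i\<in>I. q i)" unfolding int_dvd_int_iff using assms(2) i(1) by (rule dvd_prodI)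
    then have "int (q i) dvd 1" using i(2) gcd gcd_greatest by metis
    then show False using assms(1)[OF i(1)] by auto
  qed
next
  assume ndvd: "\<forall>i\<in>I. \<not> int (q i) dvd a"
  have "algebraic_semidom_class.coprime a (\<Prod>i\<in>I. int (q i))"
  proof (rule prod_coprime_right)
    fix i assume i: "i \<in> I"
    then have "algebraic_semidom_class.coprime (int (q i)) a"
      using assms(1) ndvd by (intro prime_imp_coprime) auto
    then show "algebraic_semidom_class.coprime a (int (q i))"
      by (simp only: algebraic_semidom_class.coprime_commute)
  qed
  then show "gcd a (int (\<Prod>i\<in>I. q i)) = 1" by (simp add: coprime_iff_gcd_eq_1)
qed

theorem theorem5p4:
  fixes n r M :: nat and p :: "nat \<Rightarrow> nat" and \<mu> :: "nat \<Rightarrow> nat multiset"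
    and \<alpha> :: real and B :: int
  assumes "n \<ge> 2"
    and "\<alpha> > 0"
    and gallagher: "\<And>B' :: int. B' > 2 \<Longrightarrow>
      real (card {f \<in> monic_box n B'. \<not> has_galois_group_Sn n f})
        \<le> \<alpha> * (2 * real_of_int B') ^ n * (ln (real_of_int B') / sqrt (real_of_int B'))"
    and "\<And>i. i \<in> {1..r} \<Longrightarrow> prime (p i)"
    and "inj_on p {1..r}"
    and "\<And>i. i \<in> {1..r} \<Longrightarrow> is_partition_of (\<mu> i) n"
    and "M = (\<Prod>i=1..r. p i)"
    and "B \<ge> 4 * int n * int M"
  shows "\<bar>real (card (monic_box_split n B r p \<mu>)) / real (card (monic_box_coprime n B M))
            - (\<Prod>i=1..r. nu_star n (p i) (\<mu> i))\<bar>
          \<le> 2 * (\<Prod>i=1..r. inverse (1 - 1 / real (p i))) * \<alpha>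
                * (ln (real_of_int B) / sqrt (real_of_int B))
             + 4 * real n * real M / real_of_int B"
proof -
  note n = \<open>n \<ge> 2\<close> and prime = assms(4) and part = assms(6) and M = assms(7) and B = assms(8)
  let ?I = "{1..r}" and ?L = "ln (real_of_int B) / sqrt (real_of_int B)"
  \<comment> \<open>The average number of integers of the interval in a residue class modulo
    \<open>M\<close>; the hypothesis on \<open>B\<close> becomes
    \<open>x \<ge> 8 * n\<close>.\<close>
  define x where "x = 2 * real_of_int B / real M"
  have Mpos: "M > 0" unfolding M using prime by (intro prod_pos) (auto dest: prime_gt_0_nat)
  have "real_of_int (4 * int n * int M) \<le> real_of_int B" using B by (simp only: of_int_le_iff)
  then have BM: "4 * real n * real M \<le> real_of_int B" by simp
  then have x: "x \<ge> 8 * real n" using Mpos by (simp add: x_def field_simps)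
  \<comment> \<open>This gives \<open>B \<ge> 8\<close>, so Gallagher's bound applies to
    \<open>B\<close>.\<close>
  have "4 * 2 * 1 \<le> 4 * int n * int M" using n Mpos by (intro mult_mono) auto
  then have B2: "B > 2" using B by linarith
  \<comment> \<open>\<open>D i\<close> and \<open>A i\<close> express the conditions at
    \<open>p i\<close> for the denominator and the numerator as sets of residues; the numerator will
    be \<open>NA - E\<close>.\<close>
  define D where "D i = {f \<in> monic_with n (\<lambda>_. {0..<int (p i)}). \<not> int (p i) dvd poly_disc f}" for i
  define A where "A i = {f \<in> D i. splitting_type (p i) f = \<mu> i}" for i
  define ND where "ND = card {f \<in> monic_box n B. \<forall>i\<in>?I. poly_mod.Mp (int (p i)) f \<in> D i}"
  define NA where "NA = card {f \<in> monic_box n B. \<forall>i\<in>?I. poly_mod.Mp (int (p i)) f \<in> A i}"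
  define E where "E = card {f \<in> monic_box n B. (\<forall>i\<in>?I. poly_mod.Mp (int (p i)) f \<in> A i)
    \<and> \<not> has_galois_group_Sn n f}"
  have local: "(poly_mod.Mp (int (p i)) f \<in> D i \<longleftrightarrow> \<not> int (p i) dvd poly_disc f) \<and>
      (poly_mod.Mp (int (p i)) f \<in> A i \<longleftrightarrow>
        \<not> int (p i) dvd poly_disc f \<and> splitting_type (p i) f = \<mu> i)"
    if "i \<in> ?I" "f \<in> monic_box n B" for i f
  proof -
    interpret poly_mod_prime "int (p i)" using prime[OF that(1)] by unfold_locales simp
    have f: "monic f" "degree f = n" using that(2) by (auto simp: monic_box_def)
    show ?thesis
      using Mp_in_reduced_monic[OF f(1)] not_dvd_poly_disc_Mp[OF f(1)] splitting_type_Mp[of f] f n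
      by (simp add: A_def D_def reduced_monic_eq_monic_with)
  qed
  have cards: "card (D i) = p i ^ (n - 1) * (p i - 1) \<and>
      nu_star n (p i) (\<mu> i) = real (card (A i)) / real (card (D i))" if "i \<in> ?I" for i
  proof -
    interpret poly_mod_prime "int (p i)" using prime[OF that] by unfold_locales simp
    show ?thesis
      using card_reduced_monic_squarefree[OF n] nu_star_eq_card_ratio[OF part[OF that] n]
      by (simp add: A_def D_def reduced_monic_eq_monic_with conj_assoc)
  qed
  have finD: "finite (D i)" for i
    unfolding D_def using finite_monic_with[of n "\<lambda>_. {0..<int (p i)}"] by simp
  define a where "a = real (\<Prod>i\<in>?I. card (A i))"
  define d where "d = real (\<Prod>i\<in>?I. card (D i))"
  \<comment> \<open>Each prime contributes
    \<open>p ^ (n - 1) * (p - 1) = p ^ n * (1 - 1 / p)\<close>; dividing by \<open>d\<close> puts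
    the inverses of the last factors into the error term.\<close>
  have d_eq: "d = real M ^ n * (\<Prod>i\<in>?I. 1 - 1 / real (p i))"
  proof -
    have "real (card (D i)) = real (p i) ^ n * (1 - 1 / real (p i))" if "i \<in> ?I" for i
    proof -
      have p: "p i > 0" using prime[OF that] prime_gt_0_nat by blast
      have "real (p i) ^ n = real (p i) ^ (n - 1) * real (p i)"
        using n by (metis One_nat_def Suc_pred not_numeral_le_zero not_gr_zero power_Suc2)
      then show ?thesis using cards[OF that] p by (simp add: of_nat_diff field_simps)
    qed
    then show ?thesis by (simp add: d_def M prod.distrib prod_power_distrib)
  qed
  have pi_pos: "(\<Prod>i\<in>?I. 1 - 1 / real (p i)) > 0"
  proof (rule prod_pos)
    fix i assume "i \<in> ?I"
    then have "real (p i) > 1" using prime prime_gt_1_nat by fastforce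
    then show "1 - 1 / real (p i) > 0" by simp
  qed
  have d: "d > 0" using Mpos pi_pos by (simp add: d_eq)
  have a: "0 \<le> a" "a \<le> d"
    unfolding a_def d_def of_nat_prod
    by (auto intro!: prod_nonneg prod_mono card_mono finD simp: A_def)
  have ratio: "(\<Prod>i=1..r. nu_star n (p i) (\<mu> i)) = a / d"
    using cards by (simp add: a_def d_def prod_dividef)
  have "x \<ge> 1" using x n by linarith
  have count: "real (\<Prod>i\<in>?I. card (S i)) * (x - 1) ^ n
        \<le> real (card {f \<in> monic_box n B. \<forall>i\<in>?I. poly_mod.Mp (int (p i)) f \<in> S i})"
      "real (card {f \<in> monic_box n B. \<forall>i\<in>?I. poly_mod.Mp (int (p i)) f \<in> S i})
        \<le> real (\<Prod>i\<in>?I. card (S i)) * (x + 1) ^ n"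
    if "\<And>i. i \<in> ?I \<Longrightarrow> S i \<subseteq> monic_with n (\<lambda>_. {0..<int (p i)})" for S
    using monic_box_residue_count[OF finite_atLeastAtMost prime \<open>inj_on p ?I\<close> M that, of B] \<open>x \<ge> 1\<close>
    unfolding x_def by blast+
  have NA: "a * (x - 1) ^ n \<le> NA" "NA \<le> a * (x + 1) ^ n"
    unfolding a_def NA_def by (intro count; auto simp: A_def D_def)+
  have ND: "d * (x - 1) ^ n \<le> ND" "ND \<le> d * (x + 1) ^ n"
    unfolding d_def ND_def by (intro count; auto simp: D_def)+
  have fin: "finite (monic_box n B)"
    unfolding monic_box_eq_monic_with by (rule finite_monic_with) simp
  have "E \<le> card {f \<in> monic_box n B. \<not> has_galois_group_Sn n f}"
    unfolding E_def using fin by (intro card_mono) auto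
  then have "real E \<le> \<alpha> * (2 * real_of_int B) ^ n * ?L" using gallagher[OF B2] by linarith
  \<comment> \<open>Gallagher's \<open>(2 * B) ^ n\<close> becomes \<open>M ^ n * x ^ n\<close>,
    whose factor \<open>M ^ n\<close> later cancels against the one in \<open>d\<close>.\<close>
  also have "2 * real_of_int B = real M * x" using Mpos by (simp add: x_def)
  finally have E: "real E \<le> (\<alpha> * ?L * real M ^ n) * x ^ n" by (simp add: power_mult_distrib mult_ac)
  have coprime: "gcd (poly_disc f) (int M) = 1 \<longleftrightarrow> (\<forall>i\<in>?I. \<not> int (p i) dvd poly_disc f)" for f
    unfolding M using prime by (intro gcd_prod_primes_eq_1_iff) auto
  have cop: "card (monic_box_coprime n B M) = ND"
    unfolding ND_def monic_box_coprime_def coprime using local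
    by (intro arg_cong[of _ _ card]) blast
  have "monic_box_split n B r p \<mu> = {f \<in> monic_box n B. \<forall>i\<in>?I. poly_mod.Mp (int (p i)) f \<in> A i}
      - {f \<in> monic_box n B. (\<forall>i\<in>?I. poly_mod.Mp (int (p i)) f \<in> A i) \<and> \<not> has_galois_group_Sn n f}"
    unfolding monic_box_split_def M[symmetric] coprime using local by blast
  moreover have "{f \<in> monic_box n B. (\<forall>i\<in>?I. poly_mod.Mp (int (p i)) f \<in> A i) \<and> \<not> has_galois_group_Sn n f}
      \<subseteq> {f \<in> monic_box n B. \<forall>i\<in>?I. poly_mod.Mp (int (p i)) f \<in> A i}" by blast
  ultimately have "card (monic_box_split n B r p \<mu>) = NA - E" "E \<le> NA"
    unfolding NA_def E_def using fin by (simp_all add: card_Diff_subset card_mono)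
  then have split: "real (card (monic_box_split n B r p \<mu>)) = real NA - real E" by simp
  have "\<bar>(real NA - real E) / real ND - a / d\<bar> \<le> 2 * (\<alpha> * ?L * real M ^ n / d) + 8 * real n / x"
    using n by (intro ratio_deviation_bound x a d NA ND E) auto
  also have "\<alpha> * ?L * real M ^ n / d = (\<Prod>i=1..r. inverse (1 - 1 / real (p i))) * \<alpha> * ?L"
    using Mpos pi_pos by (simp add: d_eq prod_inversef[symmetric] divide_inverse)
  also have "8 * real n / x = 4 * real n * real M / real_of_int B"
    using Mpos B2 by (simp add: x_def field_simps)
  finally show ?thesis unfolding split cop ratio by (simp add: mult_ac)
qed

end
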